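(* Let $n \geq 5$ be an integer. Then: (1) the Specht module $\mathcal{S}^{(n-1,1)}$ of $S_n$ is not unisingular; (2) the Specht module $\mathcal{S}^{(n-k,1^k)}$ of $S_n$ is unisingular for every $k = 2,\dots,n-3$; and (3) the Specht module $\mathcal{S}^{(2,1^{n-2})}$ of $S_n$ is unisingular if and only if $n$ is even.
   Context: A finite-dimensional representation $\rho: G \to \mathrm{GL}(V)$ of a finite group $G$ is called unisingular if $\det(1-\rho(g)) = 0$ for all $g \in G$, i.e. every $\rho(g)$ has $1$ as an eigenvalue. For a partition $\lambda \vdash n$, $\mathcal{S}^\lambda$ denotes the Specht module: the irreducible complex representation of the symmetric group $S_n$ indexed by $\lambda$, with the standard convention that $\mathcal{S}^{(n)}$ is the trivial representation, $\mathcal{S}^{(1^n)}$ is the sign representation, and $\mathcal{S}^{(n-1,1)}$ is the standard $(n-1)$-dimensional representation (the complement of the trivial representation in the natural permutation representation $\mathbf{C}^n$). In partitions, $1^k$ means that the part $1$ is repeated $k$ times. One has $\mathcal{S}^{(n-k,1^k)} \cong \wedge^k \mathcal{S}^{(n-1,1)}$. *)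

theory Defs
  imports
    "HOL-Library.Function_Algebras"
    "HOL-Algebra.Sym_Groups"
    "Jordan_Normal_Form.Determinant"
begin

section \<open>Finite-dimensional representations and unisingularity\<close>

text \<open>The underlying space of a representation is a finite-dimensional subspace \<open>V\<close> of an
  ambient vector space; the operators \<open>\<rho> g\<close> are only constrained on \<open>V\<close>.\<close>

locale finite_dim_rep = vector_space scale
  for scale :: "'k::field \<Rightarrow> 'v::ab_group_add \<Rightarrow> 'v" +
  fixes G :: "('g, 'm) monoid_scheme"
    and V :: "'v set"
    and \<rho> :: "'g \<Rightarrow> 'v \<Rightarrow> 'v"
  assumes group_G: "Group.group G"
    and finite_G: "finite (carrier G)"
    and subspace_V: "subspace V"
    and finite_dim: "\<exists>B. finite B \<and> V = span B"
    and rep_closed: "g \<in> carrier G \<Longrightarrow> v \<in> V \<Longrightarrow> \<rho> g v \<in> V"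
    and rep_add: "g \<in> carrier G \<Longrightarrow> v \<in> V \<Longrightarrow> w \<in> V \<Longrightarrow> \<rho> g (v + w) = \<rho> g v + \<rho> g w"
    and rep_scale: "g \<in> carrier G \<Longrightarrow> v \<in> V \<Longrightarrow> \<rho> g (scale c v) = scale c (\<rho> g v)"
    and rep_one: "v \<in> V \<Longrightarrow> \<rho> \<one>\<^bsub>G\<^esub> v = v"
    and rep_mult: "g \<in> carrier G \<Longrightarrow> h \<in> carrier G \<Longrightarrow> v \<in> V \<Longrightarrow> \<rho> (g \<otimes>\<^bsub>G\<^esub> h) v = \<rho> g (\<rho> h v)"

context vector_space
begin

definition basis_list :: "'b set \<Rightarrow> 'b list \<Rightarrow> bool" where
  "basis_list V bs \<longleftrightarrow> distinct bs \<and> independent (set bs) \<and> span (set bs) = V"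

text \<open>Column \<open>j\<close> holds the coordinates of \<open>T (bs ! j)\<close>.\<close>

definition endo_mat :: "'b list \<Rightarrow> ('b \<Rightarrow> 'b) \<Rightarrow> 'a mat" where
  "endo_mat bs T =
     mat (length bs) (length bs) (\<lambda>(i, j). representation (set bs) (T (bs ! j)) (bs ! i))"

text \<open>The determinant of an endomorphism \<open>T\<close> of a finite-dimensional subspace \<open>V\<close>; it does not
  depend on the chosen basis.\<close>

definition endo_det :: "'b set \<Rightarrow> ('b \<Rightarrow> 'b) \<Rightarrow> 'a" where
  "endo_det V T = Determinant.det (local.endo_mat (SOME bs. local.basis_list V bs) T)"

end

definition unisingular ::
  "('g, 'm) monoid_scheme \<Rightarrow> ('k::field \<Rightarrow> 'v::ab_group_add \<Rightarrow> 'v) \<Rightarrow> 'v set \<Rightarrow> ('g \<Rightarrow> 'v \<Rightarrow> 'v) \<Rightarrow> bool"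
  where
  "unisingular G scale V \<rho> \<longleftrightarrow>
     (\<forall>g\<in>carrier G. vector_space.endo_det scale V (\<lambda>v. v - \<rho> g v) = 0)"


section \<open>Specht modules\<close>

text \<open>We follow James' construction. Partitions are weakly decreasing lists of positive integers.
  Rows and columns of the Young diagram are numbered from 0, the entries of a tableau are
  \<open>1, \<dots>, n\<close>.\<close>

definition diagram :: "nat list \<Rightarrow> (nat \<times> nat) set" where
  "diagram lam = {(i, j). i < length lam \<and> j < lam ! i}"

text \<open>A tableau takes the dummy value 0 outside the diagram. Permutations of \<open>{1..n}\<close> fix 0, so
  \<open>S\<^sub>n\<close> acts on tableaux by plain composition.\<close>

definition tableaux :: "nat list \<Rightarrow> (nat \<times> nat \<Rightarrow> nat) set" where
  "tableaux lam = {t. bij_betw t (diagram lam) {1..sum_list lam} \<and> (\<forall>c. c \<notin> diagram lam \<longrightarrow> t c = 0)}"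

definition row :: "nat list \<Rightarrow> (nat \<times> nat \<Rightarrow> nat) \<Rightarrow> nat \<Rightarrow> nat set" where
  "row lam t i = t ` {c \<in> diagram lam. fst c = i}"

definition column :: "nat list \<Rightarrow> (nat \<times> nat \<Rightarrow> nat) \<Rightarrow> nat \<Rightarrow> nat set" where
  "column lam t j = t ` {c \<in> diagram lam. snd c = j}"

text \<open>The tabloid \<open>{t}\<close> is the row-equivalence class of \<open>t\<close>.\<close>

definition tabloid :: "nat list \<Rightarrow> (nat \<times> nat \<Rightarrow> nat) \<Rightarrow> (nat \<times> nat \<Rightarrow> nat) set" where
  "tabloid lam t = {s \<in> tableaux lam. \<forall>i. row lam s i = row lam t i}"

definition column_stabilizer :: "nat list \<Rightarrow> (nat \<times> nat \<Rightarrow> nat) \<Rightarrow> (nat \<Rightarrow> nat) set" where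
  "column_stabilizer lam t =
     {p. p permutes {1..sum_list lam} \<and> (\<forall>j. p ` column lam t j = column lam t j)}"

text \<open>Elements of the permutation module on tabloids are represented by their coefficient
  functions, which vanish off the set of tabloids. The polytabloid of \<open>t\<close> is
  \<open>e\<^sub>t = \<Sum> sign p \<cdot> {p t}\<close>, the sum over \<open>p\<close> in the column stabilizer of \<open>t\<close>.\<close>

type_synonym tabloid_fun = "(nat \<times> nat \<Rightarrow> nat) set \<Rightarrow> complex"

definition fun_scale :: "complex \<Rightarrow> ('a \<Rightarrow> complex) \<Rightarrow> 'a \<Rightarrow> complex" where
  "fun_scale c f = (\<lambda>x. c * f x)"

definition polytabloid :: "nat list \<Rightarrow> (nat \<times> nat \<Rightarrow> nat) \<Rightarrow> tabloid_fun" where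
  "polytabloid lam t =
     (\<lambda>U. \<Sum>p\<in>column_stabilizer lam t. of_int (sign p) * of_bool (U = tabloid lam (p \<circ> t)))"

definition specht :: "nat list \<Rightarrow> tabloid_fun set" where
  "specht lam = Modules.module.span fun_scale (polytabloid lam ` tableaux lam)"

text \<open>The linear extension of \<open>{t} \<mapsto> {p t}\<close>, written in terms of coefficient functions.\<close>

definition perm_act :: "(nat \<Rightarrow> nat) \<Rightarrow> tabloid_fun \<Rightarrow> tabloid_fun" where
  "perm_act p f = (\<lambda>U. f ((\<lambda>t. Hilbert_Choice.inv p \<circ> t) ` U))"


section \<open>Specht modules are representations of the symmetric group\<close>

interpretation fun_vs: vector_space fun_scale
  by unfold_locales (auto simp: fun_scale_def fun_eq_iff algebra_simps)

lemma finite_diagram: "finite (diagram lam)"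
proof -
  have "diagram lam \<subseteq> (\<Union>i<length lam. {i} \<times> {..<lam ! i})"
    by (auto simp: diagram_def)
  then show ?thesis by (rule finite_subset) auto
qed

lemma finite_tableaux: "finite (tableaux lam)"
proof -
  have "tableaux lam \<subseteq> {t. \<forall>c. (c \<in> diagram lam \<longrightarrow> t c \<in> {1..sum_list lam}) \<and> (c \<notin> diagram lam \<longrightarrow> t c = 0)}"
    by (auto simp: tableaux_def bij_betw_def)
  then show ?thesis
    by (rule finite_subset) (intro finite_set_of_finite_funs finite_diagram, simp)
qed

lemma perm_tableau:
  assumes "p permutes {1..sum_list lam}" "t \<in> tableaux lam"
  shows "p \<circ> t \<in> tableaux lam"
proof -
  have "bij_betw (p \<circ> t) (diagram lam) {1..sum_list lam}"
    using assms permutes_imp_bij[OF assms(1)] by (auto simp: tableaux_def intro: bij_betw_trans)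
  moreover have "p 0 = 0" using assms(1) by (auto simp: permutes_def)
  ultimately show ?thesis using assms(2) by (auto simp: tableaux_def)
qed

lemma row_comp: "row lam (p \<circ> t) i = p ` row lam t i"
  by (auto simp: row_def)

lemma column_comp: "column lam (p \<circ> t) i = p ` column lam t i"
  by (auto simp: column_def)

lemma tabloid_act:
  assumes p: "p permutes {1..sum_list lam}"
  shows "(\<lambda>s. p \<circ> s) ` tabloid lam t = tabloid lam (p \<circ> t)"
proof
  show "(\<lambda>s. p \<circ> s) ` tabloid lam t \<subseteq> tabloid lam (p \<circ> t)"
    by (auto simp: tabloid_def perm_tableau[OF p] row_comp)
next
  show "tabloid lam (p \<circ> t) \<subseteq> (\<lambda>s. p \<circ> s) ` tabloid lam t"
  proof
    fix s assume s: "s \<in> tabloid lam (p \<circ> t)"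
    let ?q = "Hilbert_Choice.inv p"
    have q: "?q permutes {1..sum_list lam}" using p by (rule permutes_inv)
    have "row lam (?q \<circ> s) i = row lam t i" for i
    proof -
      have "row lam (?q \<circ> s) i = ?q ` (p ` row lam t i)"
        using s by (simp add: row_comp tabloid_def)
      also have "\<dots> = row lam t i"
        using permutes_inj[OF p] by (simp add: image_comp)
      finally show ?thesis .
    qed
    then have "?q \<circ> s \<in> tabloid lam t"
      using s by (auto simp: tabloid_def perm_tableau[OF q])
    moreover have "s = p \<circ> (?q \<circ> s)"
      using permutes_inv_o(1)[OF p] by (simp add: comp_assoc[symmetric])
    ultimately show "s \<in> (\<lambda>s. p \<circ> s) ` tabloid lam t" by blast
  qed
qed

lemma column_stabilizer_comp:
  assumes p: "p permutes {1..sum_list lam}" and c: "c \<in> column_stabilizer lam t"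
  shows "p \<circ> c \<circ> Hilbert_Choice.inv p \<in> column_stabilizer lam (p \<circ> t)"
proof -
  have "(p \<circ> c \<circ> Hilbert_Choice.inv p) ` column lam (p \<circ> t) j = column lam (p \<circ> t) j" for j
  proof -
    have "(p \<circ> c \<circ> Hilbert_Choice.inv p) ` column lam (p \<circ> t) j = p ` c ` column lam t j"
      using permutes_inj[OF p] by (simp add: column_comp image_image)
    also have "\<dots> = column lam (p \<circ> t) j"
      using c by (simp add: column_stabilizer_def column_comp)
    finally show ?thesis .
  qed
  moreover have "p \<circ> c \<circ> Hilbert_Choice.inv p permutes {1..sum_list lam}"
    using p c by (intro permutes_compose permutes_inv) (auto simp: column_stabilizer_def)
  ultimately show ?thesis by (simp add: column_stabilizer_def)
qed

lemma sign_conj: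
  assumes p: "p permutes {1..n::nat}" and c: "c permutes {1..n}"
  shows "sign (p \<circ> c \<circ> Hilbert_Choice.inv p) = sign c"
proof -
  have P: "permutation p" "permutation c" "permutation (Hilbert_Choice.inv p)"
    using p c permutes_inv[OF p] by (auto simp: permutation_permutes)
  have "sign p * sign p = 1" by (simp add: sign_def)
  with P show ?thesis
    by (simp add: sign_compose sign_inverse permutation_compose)
qed

lemma perm_act_polytabloid:
  assumes p: "p permutes {1..sum_list lam}"
  shows "perm_act p (polytabloid lam t) = polytabloid lam (p \<circ> t)"
proof
  fix U
  let ?q = "Hilbert_Choice.inv p"
  have q: "?q permutes {1..sum_list lam}" using p by (rule permutes_inv)
  have pq: "p \<circ> ?q = id" "?q \<circ> p = id" using permutes_inv_o[OF p] by auto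
  have qq: "Hilbert_Choice.inv ?q = p" using p by (rule permutes_inv_inv)
  have qpt: "?q \<circ> (p \<circ> t) = t" using pq by (simp add: comp_assoc[symmetric])
  have A: "(\<lambda>s. ?q \<circ> s) ` U = tabloid lam s \<longleftrightarrow> U = tabloid lam (p \<circ> s)" for s
  proof
    assume "(\<lambda>s. ?q \<circ> s) ` U = tabloid lam s"
    then have "(\<lambda>s. p \<circ> s) ` (\<lambda>s. ?q \<circ> s) ` U = tabloid lam (p \<circ> s)"
      using tabloid_act[OF p] by simp
    moreover have "(\<lambda>s. p \<circ> s) ` (\<lambda>s. ?q \<circ> s) ` U = U"
      using pq by (simp add: image_image comp_assoc[symmetric])
    ultimately show "U = tabloid lam (p \<circ> s)" by simp
  next
    assume "U = tabloid lam (p \<circ> s)"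
    then have "(\<lambda>s. ?q \<circ> s) ` U = tabloid lam (?q \<circ> (p \<circ> s))"
      using tabloid_act[OF q] by simp
    then show "(\<lambda>s. ?q \<circ> s) ` U = tabloid lam s"
      using pq by (simp add: comp_assoc[symmetric])
  qed
  have "perm_act p (polytabloid lam t) U =
      (\<Sum>c\<in>column_stabilizer lam t. of_int (sign c) * of_bool (U = tabloid lam (p \<circ> (c \<circ> t))))"
    by (simp add: perm_act_def polytabloid_def A)
  also have "\<dots> = (\<Sum>c\<in>column_stabilizer lam (p \<circ> t).
      of_int (sign c) * of_bool (U = tabloid lam (c \<circ> (p \<circ> t))))"
  proof (rule sum.reindex_bij_witness[where i = "\<lambda>c. ?q \<circ> c \<circ> p" and j = "\<lambda>c. p \<circ> c \<circ> ?q"])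
    fix c assume c: "c \<in> column_stabilizer lam t"
    have 1: "p \<circ> c \<circ> ?q \<circ> (p \<circ> t) = p \<circ> (c \<circ> t)"
      using qpt by (simp only: comp_assoc)
    have 2: "sign (p \<circ> c \<circ> ?q) = sign c"
      using c by (intro sign_conj[OF p]) (simp add: column_stabilizer_def)
    show "?q \<circ> (p \<circ> c \<circ> ?q) \<circ> p = c" using permutes_inverses[OF p] by (simp add: fun_eq_iff)
    show "p \<circ> c \<circ> ?q \<in> column_stabilizer lam (p \<circ> t)" by (rule column_stabilizer_comp[OF p c])
    show "of_int (sign (p \<circ> c \<circ> ?q)) * of_bool (U = tabloid lam (p \<circ> c \<circ> ?q \<circ> (p \<circ> t))) =
        (of_int (sign c) * of_bool (U = tabloid lam (p \<circ> (c \<circ> t))) :: complex)"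
      unfolding 1 2 ..
  next
    fix c assume c: "c \<in> column_stabilizer lam (p \<circ> t)"
    show "p \<circ> (?q \<circ> c \<circ> p) \<circ> ?q = c" using permutes_inverses[OF p] by (simp add: fun_eq_iff)
    show "?q \<circ> c \<circ> p \<in> column_stabilizer lam t"
      using column_stabilizer_comp[OF q c] unfolding qq qpt .
  qed
  finally show "perm_act p (polytabloid lam t) U = polytabloid lam (p \<circ> t) U"
    by (simp add: polytabloid_def)
qed

lemma perm_act_add: "perm_act p (f + g) = perm_act p f + perm_act p g"
  by (simp add: perm_act_def fun_eq_iff)

lemma perm_act_scale: "perm_act p (fun_scale c f) = fun_scale c (perm_act p f)"
  by (simp add: perm_act_def fun_scale_def)

lemma perm_act_specht:
  assumes p: "p permutes {1..sum_list lam}" and f: "f \<in> specht lam"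
  shows "perm_act p f \<in> specht lam"
proof -
  have "f \<in> fun_vs.span (polytabloid lam ` tableaux lam)" using f by (simp add: specht_def)
  then show ?thesis
  proof (induction rule: fun_vs.span_induct_alt)
    case base
    have "perm_act p 0 = 0" by (simp add: perm_act_def fun_eq_iff)
    then show ?case unfolding specht_def by (simp only: fun_vs.span_zero)
  next
    case (step c x y)
    then obtain t where t: "t \<in> tableaux lam" "x = polytabloid lam t" by auto
    have "perm_act p x \<in> specht lam"
      using t perm_tableau[OF p t(1)] 
      by (auto simp: perm_act_polytabloid[OF p] specht_def intro: fun_vs.span_base)
    with step show ?case
      unfolding perm_act_add perm_act_scale specht_def
      by (intro fun_vs.span_add fun_vs.span_scale)
  qed
qed

theorem specht_finite_dim_rep:
  "finite_dim_rep fun_scale (sym_group (sum_list lam)) (specht lam) perm_act"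
proof (intro finite_dim_rep.intro[OF fun_vs.vector_space_axioms] finite_dim_rep_axioms.intro, goal_cases)
  case 1 show ?case by (rule sym_group_is_group)
next
  case 2 show ?case by (simp add: sym_group_def finite_permutations)
next
  case 3 show ?case by (simp add: specht_def fun_vs.subspace_span)
next
  case 4 show ?case
    unfolding specht_def using finite_tableaux by (intro exI[of _ "polytabloid lam ` tableaux lam"]) simp
next
  case (5 g v) then show ?case by (simp add: sym_group_carrier perm_act_specht)
next
  case 6 show ?case by (rule perm_act_add)
next
  case 7 show ?case by (rule perm_act_scale)
next
  case 8 show ?case by (simp add: sym_group_one perm_act_def)
next
  case (9 g h v)
  then have "bij g" "bij h" by (auto simp: sym_group_carrier permutes_bij)
  then show ?case by (simp add: sym_group_mult perm_act_def o_inv_distrib image_image comp_assoc)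
qed

end

(*
  The Specht module of (n-k,1^k) is the k-th exterior power of the standard representation, i.e. the
  space of antisymmetric functions on k-tuples over {1..n} that sum to 0 in each argument, and
  unisingularity means that every permutation g fixes a nonzero such function.

  Wedge products of k linearly independent eigenvectors of g in the sum-zero hyperplane are fixed as
  soon as their eigenvalues multiply to 1. The n - 1 eigenvalues come in pairs of inverses apart from
  values 1 and -1, so even k <= n - 2 is always possible. Odd k between 3 and n - 3 reduces to even
  k - 1 by first spending an eigenvalue 1 or, if g is an n-cycle, to even k - 3 by first spending
  three roots of unity whose exponents add up to n.

  Conversely, for the standard n-cycle the discrete Fourier transform of a fixed function is
  supported on k-sets of nonzero residues with sum 0 mod n. There are none for k = 1, nor for
  k = n - 2 with n odd, since then the sum over all residues vanishes.
*)
theory Submission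
  imports Defs
begin

section \<open>Determinants and fixed vectors\<close>

text \<open>An alternating function is a reduced simplicial cycle: antisymmetry makes it a
  (k-1)-chain on the full simplex with vertices 1, ..., n, and the vanishing sums say that its
  boundary is 0. Polytabloids of a hook are boundaries of k-simplices, so the identification with
  the Specht module amounts to the acyclicity of a simplex, proved by coning from the vertex 1.

  The two directions need different information about eigenvectors. A fixed vector only has to be
  exhibited, so one wedge is enough, and a biorthogonal family certifies that it is nonzero.
  Excluding fixed vectors requires completeness, which Fourier inversion on functions of k-tuples
  supplies without a basis of the alternating functions.

  Pairing inverse eigenvalues can end with a single 1 and a single -1, whose product is not 1. For
  odd k the n-cycle is the hard case, since 1 is not among its eigenvalues on the
  hyperplane.\<close>

context vector_space
begin

lemma endo_mat_mult_vec_index: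
  assumes bs: "basis_list V bs" and c: "c \<in> carrier_vec (length bs)"
    and T: "\<And>v. v \<in> V \<Longrightarrow> T v \<in> V"
    and add: "\<And>v w. T (v + w) = T v + T w"
    and scl: "\<And>a v. T (scale a v) = scale a (T v)"
    and i: "i < length bs"
  shows "(endo_mat bs T *\<^sub>v c) $ i =
    representation (set bs) (T (\<Sum>j<length bs. scale (c $ j) (bs ! j))) (bs ! i)"
proof -
  have ind: "independent (set bs)" and sp: "span (set bs) = V"
    using bs by (auto simp: basis_list_def)
  have T0: "T 0 = 0" using add[of 0 0] by simp
  have Tsum: "T (\<Sum>j\<in>A. f j) = (\<Sum>j\<in>A. T (f j))" if "finite A" for A and f :: "nat \<Rightarrow> 'b"
    using that by (induction A) (auto simp: T0 add)
  have Tb: "T (bs ! j) \<in> span (set bs)" if "j < length bs" for j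
    using T[of "bs ! j"] sp that span_base[of "bs ! j" "set bs"] by auto
  have "representation (set bs) (T (\<Sum>j<length bs. scale (c $ j) (bs ! j))) (bs ! i)
      = (\<Sum>j<length bs. c $ j * representation (set bs) (T (bs ! j)) (bs ! i))"
    using Tb unfolding Tsum[OF finite_lessThan] scl
    by (subst representation_sum[OF ind])
      (auto intro!: span_scale sum.cong simp: representation_scale[OF ind])
  also have "\<dots> = (endo_mat bs T *\<^sub>v c) $ i"
    using c i by (simp add: endo_mat_def scalar_prod_def lessThan_atLeast0 mult.commute)
  finally show ?thesis by simp
qed

text \<open>Coordinates with respect to the chosen basis identify the kernel of the matrix with the
  kernel of \<open>T\<close> on \<open>V\<close>, and a square matrix over a field is singular
  exactly when its kernel is nonzero.\<close>

lemma endo_det_eq_0_iff: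
  assumes B: "finite B" "V = span B"
    and T: "\<And>v. v \<in> V \<Longrightarrow> T v \<in> V"
    and add: "\<And>v w. T (v + w) = T v + T w"
    and scl: "\<And>a v. T (scale a v) = scale a (T v)"
  shows "endo_det V T = 0 \<longleftrightarrow> (\<exists>v\<in>V. v \<noteq> 0 \<and> T v = 0)"
proof -
  \<comment> \<open>\<open>endo_det\<close> refers to a chosen basis, so a basis list has to exist
    before anything is known about the choice.\<close>
  obtain C where C: "C \<subseteq> V" "independent C" "V \<subseteq> span C"
    by (rule basis_exists)
  have "finite C" using independent_span_bound[OF B(1) C(2)] C(1) unfolding B(2) by blast
  then obtain cs where "set cs = C" "distinct cs" using finite_distinct_list by blast
  moreover have "span C = V"
    using C(3) span_mono[OF C(1)] by (metis B(2) span_span subset_antisym)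
  ultimately have "basis_list V cs" using C by (simp add: basis_list_def)
  define bs where "bs = (SOME bs. basis_list V bs)"
  have bs: "basis_list V bs" unfolding bs_def by (rule someI) fact
  let ?n = "length bs" and ?v = "\<lambda>c. \<Sum>j<length bs. scale (c $ j) (bs ! j)"
  have ind: "independent (set bs)" and sp: "span (set bs) = V" and dis: "distinct bs"
    using bs by (auto simp: basis_list_def)
  have bij: "bij_betw (\<lambda>j. bs ! j) {..<?n} (set bs)" by (rule bij_betw_nth) (auto simp: dis)
  have vV: "?v c \<in> V" for c
    unfolding sp[symmetric] by (intro span_sum span_scale span_base) auto
  have rep: "representation (set bs) (?v c) (bs ! i) = c $ i" if "i < ?n" for c i
  proof -
    have "representation (set bs) (?v c) (bs ! i) =
        (\<Sum>j<?n. c $ j * (if bs ! i = bs ! j then 1 else 0))"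
      by (subst representation_sum[OF ind])
        (auto intro: span_scale span_base intro!: sum.cong
          simp: representation_scale[OF ind] representation_basis[OF ind] span_base)
    also have "\<dots> = (\<Sum>j<?n. if j = i then c $ j else 0)"
      using that dis by (intro sum.cong) (auto simp: nth_eq_iff_index_eq)
    finally show ?thesis using that by simp
  qed
  have zero: "w = 0" if "w \<in> V" "\<And>i. i < ?n \<Longrightarrow> representation (set bs) w (bs ! i) = 0" for w
  proof -
    have "w = (\<Sum>b\<in>set bs. scale (representation (set bs) w b) b)"
      using sum_representation_eq[OF ind _ _ order_refl, of w] that(1) sp by simp
    also have "\<dots> = 0"
      using that(2) by (intro sum.neutral) (auto simp: in_set_conv_nth)
    finally show ?thesis .
  qed
  have E: "(endo_mat bs T *\<^sub>v c) $ i = representation (set bs) (T (?v c)) (bs ! i)"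
    if "c \<in> carrier_vec ?n" "i < ?n" for c i
    by (rule endo_mat_mult_vec_index[OF bs that(1) _ _ _ that(2)]) (simp_all add: T add scl)
  have dimA: "dim_row (endo_mat bs T) = ?n" by (simp add: endo_mat_def)
  have mv: "endo_mat bs T *\<^sub>v c = 0\<^sub>v ?n \<longleftrightarrow> T (?v c) = 0" if c: "c \<in> carrier_vec ?n" for c
  proof
    assume *: "endo_mat bs T *\<^sub>v c = 0\<^sub>v ?n"
    show "T (?v c) = 0"
    proof (rule zero[OF T[OF vV]])
      fix i assume "i < ?n"
      then show "representation (set bs) (T (?v c)) (bs ! i) = 0"
        using E[OF c] * by simp
    qed
  next
    assume "T (?v c) = 0"
    then show "endo_mat bs T *\<^sub>v c = 0\<^sub>v ?n"
      using E[OF c] dimA by (intro eq_vecI) (simp_all add: representation_zero)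
  qed
  have "endo_det V T = 0 \<longleftrightarrow> (\<exists>c. c \<in> carrier_vec ?n \<and> c \<noteq> 0\<^sub>v ?n \<and> endo_mat bs T *\<^sub>v c = 0\<^sub>v ?n)"
    unfolding endo_det_def bs_def[symmetric]
    by (rule det_0_iff_vec_prod_zero_field) (simp add: endo_mat_def)
  also have "\<dots> \<longleftrightarrow> (\<exists>v\<in>V. v \<noteq> 0 \<and> T v = 0)"
  proof (intro iffI; elim exE bexE conjE)
    fix c assume c: "c \<in> carrier_vec ?n" "c \<noteq> 0\<^sub>v ?n" "endo_mat bs T *\<^sub>v c = 0\<^sub>v ?n"
    have "?v c \<noteq> 0"
    proof
      assume "?v c = 0"
      then have "c = 0\<^sub>v ?n" using c(1) rep[of _ c] by (intro eq_vecI) (auto simp: representation_zero)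
      with c(2) show False ..
    qed
    then show "\<exists>v\<in>V. v \<noteq> 0 \<and> T v = 0" using c vV mv by blast
  next
    fix v assume v: "v \<in> V" "v \<noteq> 0" "T v = 0"
    define c where "c = Matrix.vec ?n (\<lambda>j. representation (set bs) v (bs ! j))"
    have "?v c = (\<Sum>b\<in>set bs. scale (representation (set bs) v b) b)"
      by (subst sum.reindex_bij_betw[OF bij, symmetric]) (simp add: c_def)
    also have "\<dots> = v"
      using sum_representation_eq[OF ind _ _ order_refl, of v] v(1) sp by simp
    finally have vc: "?v c = v" .
    have c: "c \<in> carrier_vec ?n" by (simp add: c_def)
    moreover have "c \<noteq> 0\<^sub>v ?n"
    proof
      assume "c = 0\<^sub>v ?n"
      then have "?v c = 0" by simp
      with vc v(2) show False by simp
    qed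
    ultimately show "\<exists>c. c \<in> carrier_vec ?n \<and> c \<noteq> 0\<^sub>v ?n \<and> endo_mat bs T *\<^sub>v c = 0\<^sub>v ?n"
      using mv[OF c] vc v(3) by auto
  qed
  finally show ?thesis .
qed

end

text \<open>The determinant of 1 - g vanishes exactly when g fixes a nonzero vector; later arguments
  use unisingularity in this form only.\<close>

lemma unisingular_specht_iff:
  assumes "sum_list lam = n"
  shows "unisingular (sym_group n) fun_scale (specht lam) perm_act \<longleftrightarrow>
    (\<forall>g. g permutes {1..n} \<longrightarrow> (\<exists>f\<in>specht lam. f \<noteq> 0 \<and> perm_act g f = f))"
proof -
  have "fun_vs.endo_det (specht lam) (\<lambda>v. v - perm_act g v) = 0 \<longleftrightarrow>
      (\<exists>f\<in>specht lam. f \<noteq> 0 \<and> f - perm_act g f = 0)" if g: "g permutes {1..n}" for g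
  proof (rule fun_vs.endo_det_eq_0_iff[of "polytabloid lam ` tableaux lam"])
    show "finite (polytabloid lam ` tableaux lam)" by (simp add: finite_tableaux)
    show "specht lam = fun_vs.span (polytabloid lam ` tableaux lam)" by (simp add: specht_def)
    show "v - perm_act g v \<in> specht lam" if "v \<in> specht lam" for v
      using that perm_act_specht[of g lam v] g assms
      unfolding specht_def by (auto intro: fun_vs.span_diff)
  qed (auto simp: perm_act_add perm_act_scale fun_vs.scale_right_diff_distrib)
  moreover have "f - perm_act g f = 0 \<longleftrightarrow> perm_act g f = f" for f :: tabloid_fun and g
    by (simp only: right_minus_eq eq_commute[of f])
  ultimately show ?thesis
    unfolding unisingular_def Ball_def sym_group_carrier by (auto simp only:)
qed

section \<open>Products of roots of unity\<close>

definition root_unity :: "nat \<Rightarrow> nat \<Rightarrow> complex" where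
  "root_unity n j = cis (2 * pi * real j / real n)"

lemma root_unity_0 [simp]: "root_unity n 0 = 1"
  by (simp add: root_unity_def)

lemma root_unity_nonzero [simp]: "root_unity n j \<noteq> 0"
  by (simp add: root_unity_def)

lemma root_unity_self: "n > 0 \<Longrightarrow> root_unity n n = 1"
  by (simp add: root_unity_def)

lemma root_unity_add: "root_unity n (i + j) = root_unity n i * root_unity n j"
  by (simp add: root_unity_def cis_mult distrib_left add_divide_distrib)

lemma root_unity_sum: "finite A \<Longrightarrow> root_unity n (\<Sum>i\<in>A. f i) = (\<Prod>i\<in>A. root_unity n (f i))"
  by (induction A rule: finite_induct) (simp_all add: root_unity_add)

lemma root_unity_mult: "root_unity n (j * i) = root_unity n j ^ i"
  by (simp add: root_unity_def DeMoivre mult_ac)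

lemma root_unity_power_commute: "root_unity n j ^ i = root_unity n i ^ j"
  by (metis mult.commute root_unity_mult)

lemma root_unity_power: "n > 0 \<Longrightarrow> root_unity n j ^ n = 1"
  by (subst root_unity_power_commute) (simp add: root_unity_self)

lemma root_unity_eq_iff:
  assumes "j < n" "l < n"
  shows "root_unity n j = root_unity n l \<longleftrightarrow> j = l"
  using bij_betw_imp_inj_on[OF bij_betw_roots_unity, of n] assms
  by (auto simp: root_unity_def dest: inj_onD)

lemma root_unity_neq_1: "0 < j \<Longrightarrow> j < n \<Longrightarrow> root_unity n j \<noteq> 1"
  using root_unity_eq_iff[of j n 0] by simp

text \<open>Tuple entries represent the residues modulo n by 1, ..., n instead of 0, ..., n - 1;
  only the representative n of 0 needs separate care.\<close>

lemma root_unity_eq_iff':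
  assumes "j \<in> {1..n}" "l \<in> {1..n}"
  shows "root_unity n j = root_unity n l \<longleftrightarrow> j = l"
proof -
  have "root_unity n j \<noteq> root_unity n l" if "j < l" "0 < j" "l \<le> n" for j l
    using that root_unity_eq_iff[of j n l] root_unity_neq_1[of j n] root_unity_self[of n]
    by (cases "l = n") auto
  from this[of j l] this[of l j] show ?thesis using assms by (cases j l rule: linorder_cases) auto
qed

text \<open>Orthogonality of characters, by the geometric series of the quotient. Values are
  compared instead of exponents because exponents range over \<open>{..<n}\<close> for eigenvectors
  and over \<open>{1..n}\<close> for tuple entries.\<close>

lemma sum_root_unity:
  assumes "n > 0"
  shows "(\<Sum>i<n. root_unity n j ^ i * inverse (root_unity n l) ^ i) =
    (if root_unity n j = root_unity n l then of_nat n else 0)"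
proof -
  let ?q = "root_unity n j * inverse (root_unity n l)"
  have "?q ^ n = 1"
    using assms by (simp add: power_mult_distrib power_inverse root_unity_power)
  then have "(\<Sum>i<n. ?q ^ i) = (if ?q = 1 then of_nat n else 0)"
    using geometric_sum[of ?q n] by auto
  moreover have "?q = 1 \<longleftrightarrow> root_unity n j = root_unity n l"
    by (auto simp: field_simps)
  ultimately show ?thesis by (simp add: power_mult_distrib)
qed

section \<open>Choosing indices whose eigenvalues multiply to 1\<close>

text \<open>An involution \<open>\<iota>\<close> with \<open>\<mu> x * \<mu> (\<iota> x) = 1\<close> pairs the indices, and its fixed
  points carry the values \<open>1\<close> and \<open>-1\<close>; among any three fixed points two carry equal values.\<close>

lemma even_subset_prod_1:
  fixes \<mu> :: "'i \<Rightarrow> complex"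
  assumes "finite R" "\<And>x. x \<in> R \<Longrightarrow> \<iota> x \<in> R" "\<And>x. x \<in> R \<Longrightarrow> \<iota> (\<iota> x) = x"
    and "\<And>x. x \<in> R \<Longrightarrow> \<mu> x * \<mu> (\<iota> x) = 1"
    and "2 * m \<le> card R" "2 * m < card R \<or> (\<forall>x\<in>R. \<iota> x \<noteq> x)"
  shows "\<exists>K\<subseteq>R. card K = 2 * m \<and> (\<Prod>x\<in>K. \<mu> x) = 1"
  using assms
proof (induction m arbitrary: R)
  case 0
  then show ?case by (intro exI[of _ "{}"]) auto
next
  case (Suc m)
  \<comment> \<open>Besides having product 1, the pair must be stable under \<open>\<iota>\<close>
    as a set, so that the involution restricts to the remaining indices.\<close>
  have "\<exists>x y. x \<in> R \<and> y \<in> R \<and> x \<noteq> y \<and> \<mu> x * \<mu> y = 1 \<and> \<iota> ` {x, y} = {x, y}"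
  proof (cases "\<exists>x\<in>R. \<iota> x \<noteq> x")
    case True
    then obtain x where x: "x \<in> R" "\<iota> x \<noteq> x" by blast
    then show ?thesis using Suc.prems(2-4)[of x] by (intro exI[of _ x] exI[of _ "\<iota> x"]) auto
  next
    case False
    have "\<mu> x = 1 \<or> \<mu> x = -1" if "x \<in> R" for x
      using Suc.prems(4)[OF that] False that square_eq_1_iff[of "\<mu> x"] by simp
    then have "\<mu> ` R \<subseteq> {1, -1}" by auto
    then have "card (\<mu> ` R) \<le> card {1, -1 :: complex}" by (rule card_mono[rotated]) simp
    \<comment> \<open>All indices are fixed by \<open>\<iota>\<close> here, so the strict inequality
      must hold and leaves at least three of them.\<close>
    also have "\<dots> < card R" using Suc.prems(5,6) False by (cases "R = {}") auto
    finally have "\<not> inj_on \<mu> R" by (metis card_image less_irrefl)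
    then obtain x y where xy: "x \<in> R" "y \<in> R" "x \<noteq> y" "\<mu> x = \<mu> y" by (auto simp: inj_on_def)
    moreover have "\<mu> x * \<mu> y = 1" using Suc.prems(4)[OF xy(1)] False xy by simp
    ultimately show ?thesis using False by (intro exI[of _ x] exI[of _ y]) auto
  qed
  then obtain x y where xy: "x \<in> R" "y \<in> R" "x \<noteq> y" "\<mu> x * \<mu> y = 1" "\<iota> ` {x, y} = {x, y}"
    by blast
  have card: "card (R - {x, y}) = card R - 2" using xy Suc.prems(1) by (simp add: card_Diff_subset)
  have "\<exists>K\<subseteq>R - {x, y}. card K = 2 * m \<and> (\<Prod>x\<in>K. \<mu> x) = 1"
  proof (rule Suc.IH)
    fix z assume z: "z \<in> R - {x, y}"
    have "\<iota> z \<notin> {x, y}"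
    proof
      assume "\<iota> z \<in> {x, y}"
      then have "\<iota> (\<iota> z) \<in> {x, y}" using xy(5) by blast
      then show False using z Suc.prems(3) by auto
    qed
    then show "\<iota> z \<in> R - {x, y}" using z Suc.prems(2) by auto
  next
    show "2 * m < card (R - {x, y}) \<or> (\<forall>z\<in>R - {x, y}. \<iota> z \<noteq> z)"
      using Suc.prems(6) unfolding card by auto
  qed (use Suc.prems card in auto)
  then obtain K where K: "K \<subseteq> R - {x, y}" "card K = 2 * m" "(\<Prod>x\<in>K. \<mu> x) = 1" by blast
  have "finite K" "x \<notin> K" "y \<notin> K" using K(1) Suc.prems(1) finite_subset by blast+
  moreover have "insert x (insert y K) \<subseteq> R" using K(1) xy(1,2) by blast
  ultimately show ?case
    using K(2,3) xy(3,4) by (intro exI[of _ "insert x (insert y K)"]) (simp add: mult.assoc[symmetric])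
qed

text \<open>The index \<open>z\<close> fills the odd place with the factor 1. Removing it keeps the
  involution and still leaves more than \<open>2 * m\<close> indices for the even case.\<close>

lemma odd_subset_prod_1:
  fixes \<mu> :: "'i \<Rightarrow> complex"
  assumes "finite I" "\<And>x. x \<in> I \<Longrightarrow> \<iota> x \<in> I" "\<And>x. x \<in> I \<Longrightarrow> \<iota> (\<iota> x) = x"
    and "\<And>x. x \<in> I \<Longrightarrow> \<mu> x * \<mu> (\<iota> x) = 1"
    and "z \<in> I" "\<iota> z = z" "\<mu> z = 1" "2 * m + 1 < card I"
  shows "\<exists>K\<subseteq>I. card K = 2 * m + 1 \<and> (\<Prod>x\<in>K. \<mu> x) = 1"
proof -
  have "\<exists>K\<subseteq>I - {z}. card K = 2 * m \<and> (\<Prod>x\<in>K. \<mu> x) = 1"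
  proof (rule even_subset_prod_1)
    show "\<iota> x \<in> I - {z}" if "x \<in> I - {z}" for x
      using that assms(2,3)[of x] assms(6) by auto
  qed (use assms in auto)
  then obtain K where K: "K \<subseteq> I - {z}" "card K = 2 * m" "(\<Prod>x\<in>K. \<mu> x) = 1" by blast
  moreover from this have "finite K" "z \<notin> K" using assms(1) finite_subset by blast+
  ultimately show ?thesis using assms(5,7) by (intro exI[of _ "insert z K"]) auto
qed

text \<open>For even n the triple contains n / 2, the only exponent that equals its own negative.
  This makes the set put aside one element smaller and leaves an involution without fixed points, so
  that all remaining exponents may be used.\<close>

lemma odd_subset_prod_1_cycle:
  assumes k: "odd k" "3 \<le> k" "k + 3 \<le> n"
  shows "\<exists>K\<subseteq>{1..<n}. card K = k \<and> (\<Prod>j\<in>K. root_unity n j) = 1"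
proof -
  have "n > 0" using k by simp
  \<comment> \<open>\<open>A\<close> has exponent sum \<open>n\<close>, and \<open>D\<close> is its closure under negation modulo \<open>n\<close>.\<close>
  define A where "A = (if even n then {1, n div 2 - 1, n div 2} else {1, 2, n - 3})"
  define D where "D = (if even n then {1, n - 1, n div 2 - 1, n div 2 + 1, n div 2} else {1, n - 1, 2, n - 2, 3, n - 3})"
  have n6: "n \<ge> 6" using k by simp
  have A: "A \<subseteq> {1..<n}" "card A = 3" "\<Sum>A = n" "A \<subseteq> D"
    and D: "D \<subseteq> {1..<n}" "card D = (if even n then 5 else 6)" "\<And>x. x \<in> D \<Longrightarrow> n - x \<in> D"
  proof -
    show "A \<subseteq> {1..<n}" unfolding A_def using n6 by auto
    show "A \<subseteq> D" unfolding A_def D_def by auto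
    show "D \<subseteq> {1..<n}" unfolding D_def using n6 by auto
    have "n div 2 - 1 \<noteq> 1" "n div 2 - 1 \<noteq> n div 2" "n div 2 \<noteq> 1" using n6 by linarith+
    moreover have "odd n \<Longrightarrow> n \<ge> 7" using n6 by presburger
    ultimately show "card A = 3" unfolding A_def by (auto simp: card_insert_if)
    show "\<Sum>A = n"
    proof (cases "even n")
      case True
      then obtain h where h: "n = 2 * h" by (rule evenE)
      have "A = {1, h - 1, h}" using h by (simp add: A_def)
      then show ?thesis using h n6 by simp
    next
      case False
      then have "n \<ge> 7" using n6 by presburger
      then have "1 \<noteq> n - 3" "2 \<noteq> n - 3" by linarith+
      then show ?thesis using False n6 by (simp add: A_def)
    qed
    show "card D = (if even n then 5 else 6)"
    proof (cases "even n")
      case True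
      then obtain h where h: "n = 2 * h" by (rule evenE)
      have "D = {1, 2 * h - 1, h - 1, h + 1, h}" using h by (simp add: D_def)
      moreover have "h \<ge> 3" using h n6 by simp
      moreover from this have "1 \<noteq> 2 * h - 1" "1 \<noteq> h - 1" "2 * h - 1 \<noteq> h - 1" "2 * h - 1 \<noteq> h + 1"
        "2 * h - 1 \<noteq> h" "h - 1 \<noteq> h + 1" "h - 1 \<noteq> h" "1 \<noteq> h"
        by linarith+
      ultimately show ?thesis using True by (simp add: card_insert_if)
    next
      case False
      then have "n \<ge> 7" using n6 by presburger
      have "n - 1 \<noteq> 3" "n - 2 \<noteq> 3" "n - 3 \<noteq> 3" "n - 1 \<noteq> 2" "n - 2 \<noteq> 2" "n - 3 \<noteq> 2"
        "n - 1 \<noteq> 1" "n - 2 \<noteq> 1" "n - 3 \<noteq> 1" "n - 1 \<noteq> n - 2" "n - 1 \<noteq> n - 3" "n - 2 \<noteq> n - 3"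
        using \<open>n \<ge> 7\<close> by linarith+
      then show ?thesis using False by (simp add: D_def card_insert_if)
    qed
    show "n - x \<in> D" if "x \<in> D" for x
    proof (cases "even n")
      case True
      then obtain h where h: "n = 2 * h" by (rule evenE)
      have "D = {1, 2 * h - 1, h - 1, h + 1, h}" using h by (simp add: D_def)
      moreover have "h \<ge> 3" using h n6 by simp
      ultimately show ?thesis using that h by auto
    next
      case False
      then have "x = 1 \<or> x = n - 1 \<or> x = 2 \<or> x = n - 2 \<or> x = 3 \<or> x = n - 3"
        using that by (simp add: D_def)
      then show ?thesis using False n6 by (elim disjE) (simp_all add: D_def)
    qed
  qed
  have fin: "finite D" "finite A" using A(1) D(1) finite_subset by blast+
  have card: "card ({1..<n} - D) = n - 1 - card D" using D(1) fin by (simp add: card_Diff_subset)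
  obtain m where m: "k = 2 * m + 3" 
  proof -
    have "k = 2 * ((k - 3) div 2) + 3" using k by presburger
    then show ?thesis using that by blast
  qed
  have "\<exists>K\<subseteq>{1..<n} - D. card K = 2 * m \<and> (\<Prod>j\<in>K. root_unity n j) = 1"
  proof (rule even_subset_prod_1[where \<iota> = "\<lambda>x. n - x"])
    fix x assume x: "x \<in> {1..<n} - D"
    then show "n - (n - x) = x" by auto
    show "n - x \<in> {1..<n} - D" using x D(3)[of "n - x"] by auto
    show "root_unity n x * root_unity n (n - x) = 1"
      using x by (subst root_unity_add[symmetric]) (auto simp: root_unity_self)
  next
    \<comment> \<open>The count is tight: n - 6 indices remain for even n and n - 7 for odd n. As k
      is odd, k + 3 \<le> n improves to k + 4 \<le> n in the latter case.\<close>
    show "2 * m \<le> card ({1..<n} - D)" unfolding card D using k m by presburger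
    show "2 * m < card ({1..<n} - D) \<or> (\<forall>x\<in>{1..<n} - D. n - x \<noteq> x)"
    proof (cases "even n")
      case True
      then have "n div 2 \<in> D" by (simp add: D_def)
      moreover have "x = n div 2" if "n - x = x" "x < n" for x using that by presburger
      ultimately show ?thesis by auto
    next
      case False
      then have "n - x \<noteq> x" if "x < n" for x using that by presburger
      then show ?thesis by auto
    qed
  qed simp
  then obtain K where K: "K \<subseteq> {1..<n} - D" "card K = 2 * m" "(\<Prod>j\<in>K. root_unity n j) = 1" by blast
  have fK: "finite K" using K(1) finite_subset by blast
  have dis: "A \<inter> K = {}" using K(1) A(4) by blast
  have "card (A \<union> K) = k" using card_Un_disjoint[OF fin(2) fK dis] A K m by simp
  moreover have "(\<Prod>j\<in>A \<union> K. root_unity n j) = 1"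
    using root_unity_sum[OF fin(2), of n "\<lambda>j. j"] K(3)
    unfolding prod.union_disjoint[OF fin(2) fK dis] A(3) root_unity_self[OF \<open>n > 0\<close>] by simp
  ultimately show ?thesis using A(1) K(1) by (intro exI[of _ "A \<union> K"]) auto
qed

declare One_nat_def [simp del]

section \<open>Antisymmetric functions\<close>

text \<open>A \<open>k\<close>-tuple is a function on \<open>nat\<close> of which only the values on \<open>{1..k}\<close> matter.\<close>

definition alternating :: "nat \<Rightarrow> nat \<Rightarrow> ((nat \<Rightarrow> nat) \<Rightarrow> complex) \<Rightarrow> bool" where
  "alternating n k \<phi> \<longleftrightarrow>
    (\<forall>b b'. (\<forall>j\<in>{1..k}. b j = b' j) \<longrightarrow> \<phi> b = \<phi> b') \<and>
    (\<forall>b \<tau>. \<tau> permutes {1..k} \<longrightarrow> \<phi> (b \<circ> \<tau>) = of_int (sign \<tau>) * \<phi> b) \<and>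
    (\<forall>b. \<forall>j\<in>{1..k}. (\<Sum>x\<in>{1..n}. \<phi> (b(j := x))) = 0)"

lemma alternating_cong:
  "alternating n k \<phi> \<Longrightarrow> (\<And>j. j \<in> {1..k} \<Longrightarrow> b j = b' j) \<Longrightarrow> \<phi> b = \<phi> b'"
  unfolding alternating_def by blast

lemma alternating_permute:
  "alternating n k \<phi> \<Longrightarrow> \<tau> permutes {1..k} \<Longrightarrow> \<phi> (b \<circ> \<tau>) = of_int (sign \<tau>) * \<phi> b"
  unfolding alternating_def by blast

lemma alternating_sum_eq_0:
  "alternating n k \<phi> \<Longrightarrow> j \<in> {1..k} \<Longrightarrow> (\<Sum>x\<in>{1..n}. \<phi> (b(j := x))) = 0"
  unfolding alternating_def by blast

lemma alternating_zero: "alternating n k (\<lambda>_. 0)"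
  by (simp add: alternating_def)

lemma alternating_add:
  assumes "alternating n k \<phi>" "alternating n k \<psi>"
  shows "alternating n k (\<lambda>b. \<phi> b + \<psi> b)"
  unfolding alternating_def
proof (intro conjI allI impI ballI)
  fix b b' :: "nat \<Rightarrow> nat" assume "\<forall>j\<in>{1..k}. b j = b' j"
  then show "\<phi> b + \<psi> b = \<phi> b' + \<psi> b'"
    using alternating_cong[OF assms(1), of b b'] alternating_cong[OF assms(2), of b b'] by simp
qed (simp_all add: alternating_permute[OF assms(1)] alternating_permute[OF assms(2)]
  alternating_sum_eq_0[OF assms(1)] alternating_sum_eq_0[OF assms(2)] sum.distrib distrib_left)

lemma alternating_scale:
  assumes "alternating n k \<phi>"
  shows "alternating n k (\<lambda>b. c * \<phi> b)"
  unfolding alternating_def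
proof (intro conjI allI impI ballI)
  fix b b' :: "nat \<Rightarrow> nat" assume "\<forall>j\<in>{1..k}. b j = b' j"
  then show "c * \<phi> b = c * \<phi> b'" using alternating_cong[OF assms, of b b'] by simp
qed (simp_all add: alternating_permute[OF assms] sum_distrib_left[symmetric]
  alternating_sum_eq_0[OF assms])

lemma alternating_lincomb:
  assumes "finite A" "\<And>i. i \<in> A \<Longrightarrow> alternating n k (\<psi> i)"
  shows "alternating n k (\<lambda>b. \<Sum>i\<in>A. c i * \<psi> i b)"
  using assms
  by (induction A rule: finite_induct)
    (simp_all add: alternating_zero alternating_add alternating_scale)

lemma alternating_not_inj:
  assumes "alternating n k \<phi>" "\<not> inj_on b {1..k}"
  shows "\<phi> b = 0"
proof -
  obtain p q where pq: "p \<in> {1..k}" "q \<in> {1..k}" "p \<noteq> q" "b p = b q"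
    using assms(2) by (auto simp: inj_on_def)
  have "b \<circ> transpose p q = b"
    using pq by (auto simp: transpose_def fun_eq_iff)
  moreover have "\<phi> (b \<circ> transpose p q) = - \<phi> b"
    using alternating_permute[OF assms(1) permutes_swap_id[OF pq(1,2)]] pq by (simp add: sign_swap_id)
  ultimately show ?thesis by simp
qed

text \<open>The sum condition in an argument with value 1 expresses the value there through tuples
  avoiding 1.\<close>

lemma alternating_eq_0:
  assumes \<phi>: "alternating n k \<phi>"
    and z: "\<And>b. b ` {1..k} \<subseteq> {2..n} \<Longrightarrow> \<phi> b = 0"
    and b: "b ` {1..k} \<subseteq> {1..n}"
  shows "\<phi> b = 0"
\<comment> \<open>Non-injective tuples give 0 by antisymmetry. In an injective one the value 1
  occupies a single position, so changing that position yields tuples avoiding 1.\<close>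
proof (cases "inj_on b {1..k} \<and> 1 \<in> b ` {1..k}")
  case True
  then obtain j where j: "j \<in> {1..k}" "b j = 1" by (metis imageE)
  have "b j \<in> {1..n}" using b j(1) by blast
  then have "n \<ge> 1" by simp
  then have "0 = \<phi> (b(j := 1)) + (\<Sum>x\<in>{2..n}. \<phi> (b(j := x)))"
    using alternating_sum_eq_0[OF \<phi> j(1), of b]
    by (simp add: sum.atLeast_Suc_atMost numeral_2_eq_2 One_nat_def)
  also have "(\<Sum>x\<in>{2..n}. \<phi> (b(j := x))) = 0"
  proof (intro sum.neutral ballI z)
    fix x assume x: "x \<in> {2..n}"
    have "b i \<in> {2..n}" if i: "i \<in> {1..k}" "i \<noteq> j" for i
    proof -
      have "b i \<noteq> 1" using True i j by (metis inj_on_eq_iff)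
      moreover have "b i \<in> {1..n}" using b i(1) by blast
      ultimately show ?thesis by auto
    qed
    then show "(b(j := x)) ` {1..k} \<subseteq> {2..n}" using x by (simp add: image_subset_iff)
  qed
  finally show ?thesis using j by (simp add: fun_upd_idem)
next
  case False
  show ?thesis
  proof (cases "inj_on b {1..k}")
    case True
    then have "1 \<notin> b ` {1..k}" using False by simp
    have "b i \<in> {2..n}" if "i \<in> {1..k}" for i
    proof -
      have "b i \<in> {1..n}" using b that by blast
      moreover have "b i \<noteq> 1" using that \<open>1 \<notin> b ` {1..k}\<close> by (metis image_eqI)
      ultimately show ?thesis by auto
    qed
    then show ?thesis by (intro z) auto
  qed (rule alternating_not_inj[OF \<phi>])
qed

section \<open>Simplicial boundaries span the alternating functions\<close>

text \<open>The boundary of the oriented simplex with vertices \<open>a 0, \<dots>, a k\<close>, evaluated at the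
  face \<open>b\<close>; these are the polytabloids of the hook.\<close>

definition boundary :: "nat \<Rightarrow> (nat \<Rightarrow> nat) \<Rightarrow> (nat \<Rightarrow> nat) \<Rightarrow> complex" where
  "boundary k a b = (\<Sum>\<sigma> | \<sigma> permutes {0..k}. of_int (sign \<sigma>) * of_bool (\<forall>j\<in>{1..k}. b j = a (\<sigma> j)))"

lemma permutes_imp_permutation: "p permutes {a..b::nat} \<Longrightarrow> permutation p"
  by (auto simp: permutation_permutes)

lemma permutes_insert_0: "\<tau> permutes {1..k} \<Longrightarrow> \<tau> permutes {0..k::nat}"
  by (erule permutes_subset) auto

text \<open>The sum over one argument is a boundary of a boundary: exchanging the omitted vertex at
  position 0 with the one at position \<open>j\<close> reverses the sign and keeps the conditions at
  all other positions, so the terms cancel.\<close>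

lemma alternating_boundary:
  assumes a: "a ` {0..k} \<subseteq> {1..n}"
  shows "alternating n k (boundary k a)"
  unfolding alternating_def
proof (intro conjI allI impI ballI)
  fix b b' :: "nat \<Rightarrow> nat" assume "\<forall>j\<in>{1..k}. b j = b' j"
  then show "boundary k a b = boundary k a b'" by (simp add: boundary_def)
next
  fix b \<tau> :: "nat \<Rightarrow> nat" assume \<tau>: "\<tau> permutes {1..k}"
  then have \<tau>': "\<tau> permutes {0..k}" by (rule permutes_insert_0)
  note P = permutes_imp_permutation
  let ?t = "Hilbert_Choice.inv \<tau>"
  have t: "?t permutes {0..k}" "?t permutes {1..k}" using \<tau> \<tau>' by (auto intro: permutes_inv)
  have "boundary k a (b \<circ> \<tau>) = (\<Sum>\<sigma> | \<sigma> permutes {0..k}.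
      of_int (sign \<tau>) * (of_int (sign \<sigma>) * of_bool (\<forall>j\<in>{1..k}. b j = a (\<sigma> j))))"
    unfolding boundary_def
  proof (rule sum.reindex_bij_witness[where i = "\<lambda>\<sigma>. \<sigma> \<circ> \<tau>" and j = "\<lambda>\<sigma>. \<sigma> \<circ> ?t"])
    fix \<sigma> assume "\<sigma> \<in> {\<sigma>. \<sigma> permutes {0..k}}"
    then have \<sigma>: "\<sigma> permutes {0..k}" by simp
    show "\<sigma> \<circ> ?t \<circ> \<tau> = \<sigma>" "\<sigma> \<circ> \<tau> \<circ> ?t = \<sigma>" using permutes_inverses[OF \<tau>] by (auto simp: fun_eq_iff)
    show "\<sigma> \<circ> ?t \<in> {\<sigma>. \<sigma> permutes {0..k}}" "\<sigma> \<circ> \<tau> \<in> {\<sigma>. \<sigma> permutes {0..k}}"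
      using \<sigma> \<tau>' t by (auto intro: permutes_compose)
    have "(\<forall>j\<in>\<tau> ` {1..k}. b j = a ((\<sigma> \<circ> ?t) j)) \<longleftrightarrow> (\<forall>j\<in>{1..k}. (b \<circ> \<tau>) j = a (\<sigma> j))"
      by (simp add: permutes_inverses[OF \<tau>])
    then have "(\<forall>j\<in>{1..k}. (b \<circ> \<tau>) j = a (\<sigma> j)) \<longleftrightarrow> (\<forall>j\<in>{1..k}. b j = a ((\<sigma> \<circ> ?t) j))"
      unfolding permutes_image[OF \<tau>] by simp
    moreover have "sign (\<sigma> \<circ> ?t) = sign \<sigma> * sign \<tau>"
      by (simp add: sign_compose sign_inverse P[OF \<sigma>] P[OF \<tau>] P[OF t(1)])
    ultimately show "of_int (sign \<tau>) *
        (of_int (sign (\<sigma> \<circ> ?t)) * of_bool (\<forall>j\<in>{1..k}. b j = a ((\<sigma> \<circ> ?t) j))) =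
        (of_int (sign \<sigma>) * of_bool (\<forall>j\<in>{1..k}. (b \<circ> \<tau>) j = a (\<sigma> j)) :: complex)"
      by (simp add: sign_def)
  qed
  then show "boundary k a (b \<circ> \<tau>) = of_int (sign \<tau>) * boundary k a b"
    by (simp add: boundary_def sum_distrib_left)
next
  fix b :: "nat \<Rightarrow> nat" and j assume j: "j \<in> {1..k}"
  define Q :: "(nat \<Rightarrow> nat) \<Rightarrow> complex" where
    "Q \<sigma> = of_bool (\<forall>i\<in>{1..k} - {j}. b i = a (\<sigma> i))" for \<sigma>
  let ?P = "{\<sigma>. \<sigma> permutes {0..k}}" and ?s = "transpose 0 j"
  have s: "?s permutes {0..k}" using j by (intro permutes_swap_id) auto
  have "(\<Sum>x\<in>{1..n}. boundary k a (b(j := x))) =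
      (\<Sum>\<sigma>\<in>?P. of_int (sign \<sigma>) * (\<Sum>x\<in>{1..n}. of_bool (\<forall>i\<in>{1..k}. (b(j := x)) i = a (\<sigma> i))))"
    unfolding boundary_def sum_distrib_left by (rule sum.swap)
  also have "\<dots> = (\<Sum>\<sigma>\<in>?P. of_int (sign \<sigma>) * Q \<sigma>)"
  proof (intro sum.cong arg_cong2[of _ _ _ _ "(*)"] refl)
    fix \<sigma> assume "\<sigma> \<in> ?P"
    then have "\<sigma> j \<in> {0..k}" using j permutes_in_image[of \<sigma> "{0..k}" j] by auto
    then have m: "a (\<sigma> j) \<in> {1..n}" using a by blast
    \<comment> \<open>Exactly one \<open>x\<close> meets the condition at position \<open>j\<close>,
      namely \<open>a (\<sigma> j)\<close>, which lies in the range of summation; \<open>Q\<close>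
      keeps the other conditions.\<close>
    have "(\<Sum>x\<in>{1..n}. of_bool (\<forall>i\<in>{1..k}. (b(j := x)) i = a (\<sigma> i))) =
        (\<Sum>x\<in>{1..n}. if x = a (\<sigma> j) then Q \<sigma> else 0)"
      using j by (intro sum.cong) (auto simp: Q_def)
    then show "(\<Sum>x\<in>{1..n}. of_bool (\<forall>i\<in>{1..k}. (b(j := x)) i = a (\<sigma> i))) = Q \<sigma>"
      using m by (simp add: sum.delta)
  qed
  finally have bdry_eq: "(\<Sum>x\<in>{1..n}. boundary k a (b(j := x))) = (\<Sum>\<sigma>\<in>?P. of_int (sign \<sigma>) * Q \<sigma>)" .
  have "(\<Sum>\<sigma>\<in>?P. of_int (sign \<sigma>) * Q \<sigma>) = (\<Sum>\<sigma>\<in>?P. - (of_int (sign \<sigma>) * Q \<sigma>))"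
  proof (rule sum.reindex_bij_witness[where i = "\<lambda>\<sigma>. \<sigma> \<circ> ?s" and j = "\<lambda>\<sigma>. \<sigma> \<circ> ?s"])
    fix \<sigma> assume "\<sigma> \<in> ?P"
    then have \<sigma>: "\<sigma> permutes {0..k}" by simp
    show "\<sigma> \<circ> ?s \<circ> ?s = \<sigma>" "\<sigma> \<circ> ?s \<circ> ?s = \<sigma>" by (auto simp: fun_eq_iff)
    show "\<sigma> \<circ> ?s \<in> ?P" "\<sigma> \<circ> ?s \<in> ?P" using \<sigma> s by (auto intro: permutes_compose)
    have "Q (\<sigma> \<circ> ?s) = Q \<sigma>" by (auto simp: Q_def transpose_def)
    moreover have "sign (\<sigma> \<circ> ?s) = - sign \<sigma>"
      using j permutes_imp_permutation[OF \<sigma>] permutes_imp_permutation[OF s]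
      by (auto simp: sign_compose sign_swap_id)
    ultimately show "- (of_int (sign (\<sigma> \<circ> ?s)) * Q (\<sigma> \<circ> ?s)) = of_int (sign \<sigma>) * Q \<sigma>"
      by simp
  qed
  then have "(\<Sum>\<sigma>\<in>?P. of_int (sign \<sigma>) * Q \<sigma>) = - (\<Sum>\<sigma>\<in>?P. of_int (sign \<sigma>) * Q \<sigma>)"
    by (simp only: sum_negf)
  with bdry_eq show "(\<Sum>x\<in>{1..n}. boundary k a (b(j := x))) = 0" by simp
qed

text \<open>A face of the cone that avoids the apex 1 arises only by omitting the apex: if
  \<open>\<sigma>\<close> moves 0, then some position \<open>j\<close> in \<open>{1..k}\<close>
  would force \<open>b j = 1\<close>. What remains is the antisymmetrised indicator of
  \<open>c\<close>.\<close>

lemma boundary_cone: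
  assumes b: "b ` {1..k} \<subseteq> {2..n}"
  shows "boundary k (c(0 := 1)) b =
    (\<Sum>\<sigma> | \<sigma> permutes {1..k}. of_int (sign \<sigma>) * of_bool (\<forall>j\<in>{1..k}. b j = c (\<sigma> j)))"
proof -
  have "boundary k (c(0 := 1)) b = (\<Sum>\<sigma> | \<sigma> permutes {1..k}.
      of_int (sign \<sigma>) * of_bool (\<forall>j\<in>{1..k}. b j = (c(0 := 1)) (\<sigma> j)))"
    unfolding boundary_def
  proof (intro sum.mono_neutral_right ballI)
    show "finite {\<sigma>. \<sigma> permutes {0..k}}" by (simp add: finite_permutations)
    show "{\<sigma>. \<sigma> permutes {1..k}} \<subseteq> {\<sigma>. \<sigma> permutes {0..k}}"
      using permutes_insert_0 by blast
    fix \<sigma> assume "\<sigma> \<in> {\<sigma>. \<sigma> permutes {0..k}} - {\<sigma>. \<sigma> permutes {1..k}}"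
    then have \<sigma>: "\<sigma> permutes {0..k}" "\<not> \<sigma> permutes {1..k}" by auto
    have "\<sigma> 0 \<noteq> 0"
    proof
      assume "\<sigma> 0 = 0"
      then have "\<sigma> permutes {1..k}" by (intro permutes_superset[OF \<sigma>(1)]) (auto simp: not_less_eq_eq One_nat_def)
      with \<sigma>(2) show False ..
    qed
    moreover obtain j where j: "j \<in> {0..k}" "\<sigma> j = 0"
      using permutes_image[OF \<sigma>(1)] by (metis atLeastAtMost_iff imageE le0)
    ultimately have "j \<in> {1..k}" by (cases j) auto
    moreover from this have "b j \<in> {2..n}" using b by blast
    ultimately show "of_int (sign \<sigma>) * of_bool (\<forall>j\<in>{1..k}. b j = (c(0 := 1)) (\<sigma> j)) = (0::complex)"
      using j(2) by force
  qed
  also have "\<dots> = (\<Sum>\<sigma> | \<sigma> permutes {1..k}. of_int (sign \<sigma>) * of_bool (\<forall>j\<in>{1..k}. b j = c (\<sigma> j)))"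
  proof (rule sum.cong[OF refl])
    fix \<sigma> assume "\<sigma> \<in> {\<sigma>. \<sigma> permutes {1..k}}"
    then have "\<sigma> j \<noteq> 0" if "j \<in> {1..k}" for j
      using that permutes_in_image[of \<sigma> "{1..k}" j] by auto
    then have "(\<forall>j\<in>{1..k}. b j = (c(0 := 1)) (\<sigma> j)) \<longleftrightarrow> (\<forall>j\<in>{1..k}. b j = c (\<sigma> j))"
      by (metis fun_upd_other)
    then show "of_int (sign \<sigma>) * of_bool (\<forall>j\<in>{1..k}. b j = (c(0 := 1)) (\<sigma> j)) =
        (of_int (sign \<sigma>) * of_bool (\<forall>j\<in>{1..k}. b j = c (\<sigma> j)) :: complex)"
      by (simp only:)
  qed
  finally show ?thesis .
qed

text \<open>Both sides are alternating, so it suffices to compare them on tuples avoiding 1. There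
  each permutation contributes one copy of \<open>\<phi> b\<close>, its sign cancelling against the
  antisymmetry of \<open>\<phi>\<close>; the factor \<open>fact k\<close> counts these
  copies.\<close>

lemma alternating_eq_boundaries:
  assumes \<phi>: "alternating n k \<phi>" and b: "b ` {1..k} \<subseteq> {1..n}" and n: "n \<ge> 1"
  shows "fact k * \<phi> b = (\<Sum>c\<in>{1..k} \<rightarrow>\<^sub>E {2..n}. \<phi> c * boundary k (c(0 := 1)) b)"
proof -
  let ?C = "{1..k} \<rightarrow>\<^sub>E {2..n}"
  have fin: "finite ?C" by (intro finite_PiE) auto
  define \<psi> where "\<psi> b = fact k * \<phi> b + (-1) * (\<Sum>c\<in>?C. \<phi> c * boundary k (c(0 := 1)) b)" for b
  have "alternating n k \<psi>"
  proof -
    have "alternating n k (boundary k (c(0 := 1)))" if "c \<in> ?C" for c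
    proof (rule alternating_boundary, rule image_subsetI)
      fix x assume "x \<in> {0..k}"
      then show "(c(0 := 1)) x \<in> {1..n}"
        using n PiE_mem[OF that, of x] by (cases "x = 0") auto
    qed
    then show ?thesis
      unfolding \<psi>_def by (intro alternating_add alternating_scale alternating_lincomb fin \<phi>)
  qed
  moreover have "\<psi> b = 0" if b: "b ` {1..k} \<subseteq> {2..n}" for b
  proof -
    have "(\<Sum>c\<in>?C. \<phi> c * boundary k (c(0 := 1)) b) =
        (\<Sum>\<sigma> | \<sigma> permutes {1..k}. of_int (sign \<sigma>) *
          (\<Sum>c\<in>?C. \<phi> c * of_bool (\<forall>j\<in>{1..k}. b j = c (\<sigma> j))))"
      unfolding boundary_cone[OF b] sum_distrib_left
      by (subst sum.swap) (simp add: mult.left_commute)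
    also have "\<dots> = (\<Sum>\<sigma> | \<sigma> permutes {1..k}. \<phi> b)"
    proof (rule sum.cong[OF refl])
      fix \<sigma> assume "\<sigma> \<in> {\<sigma>. \<sigma> permutes {1..k}}"
      then have \<sigma>: "\<sigma> permutes {1..k}" by simp
      let ?s = "Hilbert_Choice.inv \<sigma>"
      have s: "?s permutes {1..k}" using \<sigma> by (rule permutes_inv)
      \<comment> \<open>\<open>d\<close> is \<open>b\<close> rearranged by the inverse of
        \<open>\<sigma>\<close> and cut off to a member of the index set; it is the only
        \<open>c\<close> that contributes for this \<open>\<sigma>\<close>.\<close>
      define d where "d = restrict (b \<circ> ?s) {1..k}"
      have d: "d \<in> ?C" unfolding d_def using b permutes_in_image[OF s] by (auto simp: image_subset_iff)
      have "(\<forall>j\<in>{1..k}. b j = c (\<sigma> j)) \<longleftrightarrow> c = d" if c: "c \<in> ?C" for c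
      proof
        assume *: "\<forall>j\<in>{1..k}. b j = c (\<sigma> j)"
        show "c = d"
        proof (rule PiE_ext[OF c d])
          fix j assume "j \<in> {1..k}"
          moreover from this have "?s j \<in> {1..k}" using s by (simp only: permutes_in_image)
          ultimately show "c j = d j"
            using * permutes_inverses(1)[OF \<sigma>, of j] by (simp add: d_def)
        qed
      next
        assume "c = d"
        then show "\<forall>j\<in>{1..k}. b j = c (\<sigma> j)"
          using \<sigma> permutes_in_image[OF \<sigma>] permutes_inverses(2)[OF \<sigma>] by (simp add: d_def)
      qed
      then have "(\<Sum>c\<in>?C. \<phi> c * of_bool (\<forall>j\<in>{1..k}. b j = c (\<sigma> j))) =
          (\<Sum>c\<in>?C. if c = d then \<phi> c else 0)"
        by (intro sum.cong refl) simp
      also have "\<dots> = \<phi> d" using fin d by simp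
      also have "\<dots> = \<phi> (b \<circ> ?s)" by (intro alternating_cong[OF \<phi>]) (simp add: d_def)
      also have "\<dots> = of_int (sign \<sigma>) * \<phi> b"
        using alternating_permute[OF \<phi> s] permutes_imp_permutation[OF \<sigma>] by (simp add: sign_inverse)
      finally show "of_int (sign \<sigma>) * (\<Sum>c\<in>?C. \<phi> c * of_bool (\<forall>j\<in>{1..k}. b j = c (\<sigma> j))) = \<phi> b"
        by (simp add: sign_def)
    qed
    also have "\<dots> = fact k * \<phi> b"
      using card_permutations[of "{1..k}" k] by simp
    finally show ?thesis by (simp add: \<psi>_def)
  qed
  ultimately have "\<psi> b = 0" by (rule alternating_eq_0[OF _ _ b])
  then show ?thesis by (simp add: \<psi>_def)
qed

section \<open>Wedge products, as determinants of the matrices with entries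
  \<open>v i (b j)\<close>\<close>

definition wedge :: "nat \<Rightarrow> (nat \<Rightarrow> nat \<Rightarrow> complex) \<Rightarrow> (nat \<Rightarrow> nat) \<Rightarrow> complex" where
  "wedge k v b = (\<Sum>\<sigma> | \<sigma> permutes {1..k}. of_int (sign \<sigma>) * (\<Prod>j\<in>{1..k}. v (\<sigma> j) (b j)))"

text \<open>Each term depends on argument \<open>j\<close> through a single factor
  \<open>v (\<sigma> j)\<close>, and this factor sums to 0.\<close>

lemma alternating_wedge:
  assumes v: "\<And>i. i \<in> {1..k} \<Longrightarrow> (\<Sum>x\<in>{1..n}. v i x) = 0"
  shows "alternating n k (wedge k v)"
  unfolding alternating_def
proof (intro conjI allI impI ballI)
  fix b b' :: "nat \<Rightarrow> nat" assume "\<forall>j\<in>{1..k}. b j = b' j"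
  then show "wedge k v b = wedge k v b'" by (simp add: wedge_def)
next
  fix b \<tau> :: "nat \<Rightarrow> nat" assume \<tau>: "\<tau> permutes {1..k}"
  note P = permutes_imp_permutation
  let ?t = "Hilbert_Choice.inv \<tau>"
  have t: "?t permutes {1..k}" using \<tau> by (auto intro: permutes_inv)
  have "wedge k v (b \<circ> \<tau>) = (\<Sum>\<sigma> | \<sigma> permutes {1..k}.
      of_int (sign \<tau>) * (of_int (sign \<sigma>) * (\<Prod>j\<in>{1..k}. v (\<sigma> j) (b j))))"
    unfolding wedge_def
  proof (rule sum.reindex_bij_witness[where i = "\<lambda>\<sigma>. \<sigma> \<circ> \<tau>" and j = "\<lambda>\<sigma>. \<sigma> \<circ> ?t"])
    fix \<sigma> assume "\<sigma> \<in> {\<sigma>. \<sigma> permutes {1..k}}"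
    then have \<sigma>: "\<sigma> permutes {1..k}" by simp
    show "\<sigma> \<circ> ?t \<circ> \<tau> = \<sigma>" "\<sigma> \<circ> \<tau> \<circ> ?t = \<sigma>" using permutes_inverses[OF \<tau>] by (auto simp: fun_eq_iff)
    show "\<sigma> \<circ> ?t \<in> {\<sigma>. \<sigma> permutes {1..k}}" "\<sigma> \<circ> \<tau> \<in> {\<sigma>. \<sigma> permutes {1..k}}"
      using \<sigma> \<tau> t by (auto intro: permutes_compose)
    have "(\<Prod>j\<in>{1..k}. v (\<sigma> j) ((b \<circ> \<tau>) j)) = (\<Prod>j\<in>{1..k}. v ((\<sigma> \<circ> ?t) j) (b j))"
      by (subst prod.permute[OF \<tau>]) (simp add: permutes_inverses[OF \<tau>] o_def)
    moreover have "sign (\<sigma> \<circ> ?t) = sign \<sigma> * sign \<tau>"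
      by (simp add: sign_compose sign_inverse P[OF \<sigma>] P[OF \<tau>] P[OF t(1)])
    ultimately show "of_int (sign \<tau>) *
        (of_int (sign (\<sigma> \<circ> ?t)) * (\<Prod>j\<in>{1..k}. v ((\<sigma> \<circ> ?t) j) (b j))) =
        (of_int (sign \<sigma>) * (\<Prod>j\<in>{1..k}. v (\<sigma> j) ((b \<circ> \<tau>) j)))"
      by (simp add: sign_def)
  qed
  then show "wedge k v (b \<circ> \<tau>) = of_int (sign \<tau>) * wedge k v b"
    by (simp add: wedge_def sum_distrib_left)
next
  fix b :: "nat \<Rightarrow> nat" and j assume j: "j \<in> {1..k}"
  have "(\<Sum>x\<in>{1..n}. wedge k v (b(j := x))) = (\<Sum>\<sigma> | \<sigma> permutes {1..k}.
      of_int (sign \<sigma>) * (\<Sum>x\<in>{1..n}. \<Prod>i\<in>{1..k}. v (\<sigma> i) ((b(j := x)) i)))"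
    unfolding wedge_def sum_distrib_left by (rule sum.swap)
  also have "\<dots> = 0"
  proof (intro sum.neutral ballI)
    fix \<sigma> assume "\<sigma> \<in> {\<sigma>. \<sigma> permutes {1..k}}"
    then have \<sigma>: "\<sigma> j \<in> {1..k}" using permutes_in_image[of \<sigma> "{1..k}" j] j by simp
    have "(\<Prod>i\<in>{1..k}. v (\<sigma> i) ((b(j := x)) i)) = v (\<sigma> j) x * (\<Prod>i\<in>{1..k} - {j}. v (\<sigma> i) (b i))" for x
      using j by (subst prod.remove[of _ j]) (auto intro!: prod.cong)
    then have "(\<Sum>x\<in>{1..n}. \<Prod>i\<in>{1..k}. v (\<sigma> i) ((b(j := x)) i)) = 0"
      using v[OF \<sigma>] by (simp add: sum_distrib_right[symmetric])
    then show "of_int (sign \<sigma>) * (\<Sum>x\<in>{1..n}. \<Prod>i\<in>{1..k}. v (\<sigma> i) ((b(j := x)) i)) = 0"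
      by simp
  qed
  finally show "(\<Sum>x\<in>{1..n}. wedge k v (b(j := x))) = 0" .
qed

text \<open>Every term of the determinant uses each eigenvector once, so all terms acquire the same
  product of eigenvalues.\<close>

lemma wedge_comp:
  assumes v: "\<And>i x. i \<in> {1..k} \<Longrightarrow> x \<in> {1..n} \<Longrightarrow> v i (h x) = \<mu> i * v i x"
    and b: "b ` {1..k} \<subseteq> {1..n}"
  shows "wedge k v (h \<circ> b) = (\<Prod>i\<in>{1..k}. \<mu> i) * wedge k v b"
proof -
  have "(\<Prod>j\<in>{1..k}. v (\<sigma> j) ((h \<circ> b) j)) = (\<Prod>i\<in>{1..k}. \<mu> i) * (\<Prod>j\<in>{1..k}. v (\<sigma> j) (b j))"
    if \<sigma>: "\<sigma> permutes {1..k}" for \<sigma>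
  proof -
    have "(\<Prod>j\<in>{1..k}. v (\<sigma> j) ((h \<circ> b) j)) = (\<Prod>j\<in>{1..k}. \<mu> (\<sigma> j) * v (\<sigma> j) (b j))"
    proof (intro prod.cong refl)
      fix j assume j: "j \<in> {1..k}"
      then have "\<sigma> j \<in> {1..k}" "b j \<in> {1..n}" using b permutes_in_image[OF \<sigma>] by blast+
      then show "v (\<sigma> j) ((h \<circ> b) j) = \<mu> (\<sigma> j) * v (\<sigma> j) (b j)" by (simp add: v)
    qed
    also have "\<dots> = (\<Prod>i\<in>{1..k}. \<mu> i) * (\<Prod>j\<in>{1..k}. v (\<sigma> j) (b j))"
      by (subst (2) prod.permute[OF \<sigma>]) (simp add: prod.distrib o_def)
    finally show ?thesis .
  qed
  then show ?thesis
    unfolding wedge_def sum_distrib_left by (intro sum.cong refl) (simp add: mult.left_commute)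
qed

text \<open>The Gram determinant of two biorthonormal families is 1.\<close>

lemma wedge_neq_0:
  assumes vw: "\<And>i j. i \<in> {1..k} \<Longrightarrow> j \<in> {1..k} \<Longrightarrow>
    (\<Sum>x\<in>{1..n}. v i x * w j x) = (if i = j then 1 else 0)"
  shows "\<exists>b\<in>{1..k} \<rightarrow>\<^sub>E {1..n}. wedge k v b \<noteq> 0"
proof -
  \<comment> \<open>Pairing with the pure tensor of the \<open>w j\<close> turns each term into a
    product of the pairings of \<open>v (\<sigma> j)\<close> with \<open>w j\<close>, and
    biorthogonality leaves only the identity.\<close>
  have "(\<Sum>b\<in>{1..k} \<rightarrow>\<^sub>E {1..n}. wedge k v b * (\<Prod>j\<in>{1..k}. w j (b j))) =
      (\<Sum>\<sigma> | \<sigma> permutes {1..k}. of_int (sign \<sigma>) *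
        (\<Sum>b\<in>{1..k} \<rightarrow>\<^sub>E {1..n}. \<Prod>j\<in>{1..k}. v (\<sigma> j) (b j) * w j (b j)))"
    unfolding wedge_def sum_distrib_left sum_distrib_right
    by (subst sum.swap) (simp add: prod.distrib mult.assoc)
  also have "\<dots> = (\<Sum>\<sigma> | \<sigma> permutes {1..k}. if \<sigma> = id then 1 else 0)"
  proof (rule sum.cong[OF refl])
    fix \<sigma> assume "\<sigma> \<in> {\<sigma>. \<sigma> permutes {1..k}}"
    then have \<sigma>: "\<sigma> permutes {1..k}" by simp
    have "(\<Sum>b\<in>{1..k} \<rightarrow>\<^sub>E {1..n}. \<Prod>j\<in>{1..k}. v (\<sigma> j) (b j) * w j (b j)) =
        (\<Prod>j\<in>{1..k}. \<Sum>x\<in>{1..n}. v (\<sigma> j) x * w j x)"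
      by (rule prod_sum_PiE[symmetric]) auto
    also have "\<dots> = (\<Prod>j\<in>{1..k}. if \<sigma> j = j then 1 else 0)"
      using permutes_in_image[OF \<sigma>] by (intro prod.cong refl vw) blast+
    finally have E: "(\<Sum>b\<in>{1..k} \<rightarrow>\<^sub>E {1..n}. \<Prod>j\<in>{1..k}. v (\<sigma> j) (b j) * w j (b j)) =
        (\<Prod>j\<in>{1..k}. if \<sigma> j = j then 1 else 0)" .
    show "of_int (sign \<sigma>) * (\<Sum>b\<in>{1..k} \<rightarrow>\<^sub>E {1..n}. \<Prod>j\<in>{1..k}. v (\<sigma> j) (b j) * w j (b j)) =
        (if \<sigma> = id then 1 else 0)"
    proof (cases "\<sigma> = id")
      case False
      then obtain j where "\<sigma> j \<noteq> j" by (auto simp: fun_eq_iff)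
      moreover from this have "j \<in> {1..k}" using permutes_not_in[OF \<sigma>] by blast
      ultimately have "(\<Prod>j\<in>{1..k}. if \<sigma> j = j then 1 else 0) = (0::complex)"
        by (intro prod_zero) auto
      then show ?thesis using False E by simp
    qed (unfold E, simp)
  qed
  also have "\<dots> = 1" by (simp add: finite_permutations permutes_id)
  finally have "(\<Sum>b\<in>{1..k} \<rightarrow>\<^sub>E {1..n}. wedge k v b * (\<Prod>j\<in>{1..k}. w j (b j))) \<noteq> 0" by simp
  then show ?thesis by (metis (no_types, lifting) mult_zero_left sum.neutral)
qed

section \<open>Invariant wedges of eigenvectors\<close>

text \<open>Provides coordinates on \<open>S\<close>: a cycle, named by its representative in
  \<open>B\<close>, and a position below its length \<open>L\<close>.\<close>

lemma cycle_decomposition: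
  assumes g: "g permutes S" and S: "finite S"
  obtains B L where "B \<subseteq> S" "\<And>c. c \<in> B \<Longrightarrow> 0 < L c" "\<And>c. c \<in> B \<Longrightarrow> (g ^^ L c) c = c"
    "bij_betw (\<lambda>(c, i). (g ^^ i) c) (SIGMA c:B. {..<L c}) S"
proof -
  have perm: "permutation g" using g S by (auto simp: permutation_permutes)
  define Orb where "Orb a = set (support g a)" for a
  \<comment> \<open>The representative depends on the orbit as a set only, so all points of a cycle
    select the same one.\<close>
  define r where "r X = (SOME x. x \<in> X)" for X :: "'a set"
  have self: "a \<in> Orb a" for a
    unfolding Orb_def using least_power_of_permutation(2)[OF perm, of a] by (force intro: image_eqI[of _ _ 0])
  have r: "r (Orb a) \<in> Orb a" for a unfolding r_def using self by (rule someI)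
  have eq: "Orb a = Orb b" if "x \<in> Orb a" "x \<in> Orb b" for a b x
    using disjoint_support[OF perm] that unfolding Orb_def disjoint_def by blast
  have OS: "Orb a \<subseteq> S" if "a \<in> S" for a
    unfolding Orb_def using permutes_in_image[OF permutes_funpow[OF g]] that by auto
  define B where "B = (\<lambda>a. r (Orb a)) ` S"
  have rB: "r (Orb c) = c" if "c \<in> B" for c
    using that r self eq unfolding B_def by (metis imageE)
  show thesis
  proof (rule that[of B "least_power g"])
    show "B \<subseteq> S" using r OS by (auto simp: B_def)
    show "0 < least_power g c" "(g ^^ least_power g c) c = c" for c
      using least_power_of_permutation[OF perm] by auto
    show "bij_betw (\<lambda>(c, i). (g ^^ i) c) (SIGMA c:B. {..<least_power g c}) S"
      unfolding bij_betw_def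
    proof
      show "inj_on (\<lambda>(c, i). (g ^^ i) c) (SIGMA c:B. {..<least_power g c})"
      proof (rule inj_onI, clarify, rule conjI)
        fix c i d j assume c: "c \<in> B" "i < least_power g c" and d: "d \<in> B" "j < least_power g d"
          and e: "(g ^^ i) c = (g ^^ j) d"
        have "(g ^^ i) c \<in> Orb c" "(g ^^ j) d \<in> Orb d" using c d by (auto simp: Orb_def)
        then show cd: "c = d" using eq rB c(1) d(1) e by metis
        have "inj_on (\<lambda>i. (g ^^ i) c) {0..<least_power g c}"
          using cycle_of_permutation[OF perm, of c] by (simp add: distinct_map)
        then show "i = j" using c(2) d(2) e cd by (auto dest: inj_onD)
      qed
      show "(\<lambda>(c, i). (g ^^ i) c) ` (SIGMA c:B. {..<least_power g c}) = S"
      proof (intro equalityI subsetI)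
        fix x assume "x \<in> (\<lambda>(c, i). (g ^^ i) c) ` (SIGMA c:B. {..<least_power g c})"
        then show "x \<in> S"
          using \<open>B \<subseteq> S\<close> permutes_in_image[OF permutes_funpow[OF g]] by auto
      next
        fix x assume "x \<in> S"
        define c where "c = r (Orb x)"
        have "x \<in> Orb c" using r self eq unfolding c_def by metis
        moreover have "c \<in> B" using \<open>x \<in> S\<close> by (simp add: B_def c_def)
        ultimately show "x \<in> (\<lambda>(c, i). (g ^^ i) c) ` (SIGMA c:B. {..<least_power g c})"
          by (force simp: Orb_def)
      qed
    qed
  qed
qed

lemma root_unity_power_mod: "n > 0 \<Longrightarrow> root_unity n j ^ (i mod n) = root_unity n j ^ i"
  by (subst (2) mult_div_mod_eq[of n i, symmetric])
    (simp only: power_add power_mult root_unity_power power_one mult_1)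

text \<open>Along a cycle of length \<open>L\<close> the vectors \<open>i \<mapsto> \<zeta>\<^sup>i\<close> with \<open>\<zeta>\<^sup>L = 1\<close> diagonalise \<open>g\<close>; subtracting
  the indicator of a fixed cycle \<open>c0\<close> moves the invariant ones into the sum-zero hyperplane.\<close>

lemma eigenvectors:
  assumes g: "g permutes {1..n}" and n: "n \<ge> 1"
  obtains I :: "(nat \<times> nat) set" and \<iota> \<mu> v w where
    "finite I" "card I = n - 1" "\<And>x. x \<in> I \<Longrightarrow> \<iota> x \<in> I" "\<And>x. x \<in> I \<Longrightarrow> \<iota> (\<iota> x) = x"
    "\<And>x. x \<in> I \<Longrightarrow> \<mu> x * \<mu> (\<iota> x) = (1::complex)"
    "\<And>i. i \<in> I \<Longrightarrow> (\<Sum>x\<in>{1..n}. v i x) = 0"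
    "\<And>i x. i \<in> I \<Longrightarrow> x \<in> {1..n} \<Longrightarrow> v i (g x) = \<mu> i * v i x"
    "\<And>i j. i \<in> I \<Longrightarrow> j \<in> I \<Longrightarrow> (\<Sum>x\<in>{1..n}. v i x * w j x) = (if i = j then 1 else 0)"
    "(\<exists>z\<in>I. \<iota> z = z \<and> \<mu> z = 1) \<or> (\<exists>c. I = {c} \<times> {1..<n} \<and> (\<forall>j. \<mu> (c, j) = root_unity n j))"
proof -
  obtain B L where B: "B \<subseteq> {1..n}" and L: "\<And>c. c \<in> B \<Longrightarrow> 0 < L c" "\<And>c. c \<in> B \<Longrightarrow> (g ^^ L c) c = c"
    and bij: "bij_betw (\<lambda>(c, i). (g ^^ i) c) (SIGMA c:B. {..<L c}) {1..n}"
    using cycle_decomposition[OF g] by blast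
  have finB: "finite B" using B finite_subset by blast
  let ?J = "SIGMA c:B. {..<L c}" and ?\<theta> = "\<lambda>(c, i). (g ^^ i) c"
  \<comment> \<open>\<open>\<pi> x\<close> consists of the cycle through \<open>x\<close> and the
    position of \<open>x\<close> on it; \<open>g\<close> will add 1 to the position modulo the
    length.\<close>
  define \<pi> where "\<pi> = inv_into ?J ?\<theta>"
  have finJ: "finite ?J" using finB by auto
  have cardJ: "card ?J = n" using bij_betw_same_card[OF bij] by simp
  have \<pi>\<theta>: "\<pi> ((g ^^ i) c) = (c, i)" if "c \<in> B" "i < L c" for c i
    using bij_betw_inv_into_left[OF bij, of "(c, i)"] that by (simp add: \<pi>_def)
  have ex\<theta>: "\<exists>c i. c \<in> B \<and> i < L c \<and> x = (g ^^ i) c" if "x \<in> {1..n}" for x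
    using bij that unfolding bij_betw_def by fastforce
  obtain c0 where c0: "c0 \<in> B" using ex\<theta>[of 1] n by auto
  have \<pi>g: "\<pi> (g x) = (fst (\<pi> x), Suc (snd (\<pi> x)) mod L (fst (\<pi> x)))" and \<pi>B: "fst (\<pi> x) \<in> B"
    if x: "x \<in> {1..n}" for x
  proof -
    obtain c i where ci: "c \<in> B" "i < L c" "x = (g ^^ i) c" using ex\<theta>[OF x] by blast
    then show "fst (\<pi> x) \<in> B" by (simp add: \<pi>\<theta>)
    show "\<pi> (g x) = (fst (\<pi> x), Suc (snd (\<pi> x)) mod L (fst (\<pi> x)))"
    proof (cases "Suc i = L c")
      case True
      have "g x = (g ^^ 0) c" using L(2)[OF ci(1)] ci(3) by (simp add: True[symmetric])
      then show ?thesis using \<pi>\<theta>[OF ci(1) L(1)[OF ci(1)]] \<pi>\<theta>[OF ci(1,2)] ci(3) True by simp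
    next
      case False
      then have "Suc i < L c" using ci(2) by simp
      moreover have "g x = (g ^^ Suc i) c" using ci(3) by simp
      ultimately show ?thesis using \<pi>\<theta>[OF ci(1), of "Suc i"] \<pi>\<theta>[OF ci(1,2)] ci(3) by simp
    qed
  qed
  have sum: "(\<Sum>x\<in>{1..n}. f (\<pi> x)) = (\<Sum>c\<in>B. \<Sum>i<L c. f (c, i))" for f :: "nat \<times> nat \<Rightarrow> complex"
  proof -
    have "(\<Sum>x\<in>{1..n}. f (\<pi> x)) = (\<Sum>y\<in>?J. f y)"
      unfolding sum.reindex_bij_betw[OF bij, symmetric] by (intro sum.cong) (auto simp: \<pi>\<theta>)
    also have "\<dots> = (\<Sum>c\<in>B. \<Sum>i<L c. f (c, i))" by (subst sum.Sigma) (use finB in auto)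
    finally show ?thesis .
  qed
  \<comment> \<open>At \<open>(c0, 0)\<close> the corrected vector is 0. Dropping this index leaves
    n - 1, the dimension of the hyperplane.\<close>
  define I where "I = ?J - {(c0, 0)}"
  \<comment> \<open>Inverse eigenvalues belong to opposite exponents modulo the cycle length;
    exponent 0 is singled out because \<open>L c - 0\<close> is not below
    \<open>L c\<close>.\<close>
  define \<iota> where "\<iota> = (\<lambda>(c, j). (c, if j = 0 then 0 else L c - j))"
  define \<mu> where "\<mu> = (\<lambda>(c, j). root_unity (L c) j)"
  \<comment> \<open>Dividing by \<open>L c\<close> normalises the pairing with \<open>W\<close> and
    gives the uncorrected vector of exponent 0 the sum 1 on every cycle; the term subtracted on
    \<open>c0\<close> has sum 1 as well.\<close>
  define V where "V = (\<lambda>(c, j) (d, i). of_bool (d = c) * (root_unity (L c) j ^ i / of_nat (L c)) -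
    of_bool (j = 0) * of_bool (d = c0) * (1 / of_nat (L c0)) :: complex)"
  \<comment> \<open>The dual vectors stay uncorrected: the term subtracted in \<open>V\<close> pairs
    to a nonzero value with \<open>W (c0, 0)\<close> alone, whose index is outside
    \<open>I\<close>.\<close>
  define W where "W = (\<lambda>(c, j) (d, i). of_bool (d = c) * inverse (root_unity (L c) j) ^ i)"
  have pair: "(\<Sum>x\<in>{1..n}. V (c, j) (\<pi> x) * W (d, l) (\<pi> x)) =
      of_bool (c = d \<and> j = l) - of_bool (j = 0 \<and> d = c0 \<and> l = 0)"
    if "(c, j) \<in> ?J" "(d, l) \<in> ?J" for c j d l
  proof -
    have d: "d \<in> B" "l < L d" "0 < L d" and c: "c \<in> B" "j < L c" using that by auto
    have "(\<Sum>x\<in>{1..n}. V (c, j) (\<pi> x) * W (d, l) (\<pi> x)) =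
        (\<Sum>c'\<in>B. if c' = d then \<Sum>i<L d. V (c, j) (d, i) * inverse (root_unity (L d) l) ^ i else 0)"
      unfolding sum[of "\<lambda>y. V (c, j) y * W (d, l) y"] by (intro sum.cong) (auto simp: W_def)
    also have "\<dots> = (\<Sum>i<L d. V (c, j) (d, i) * inverse (root_unity (L d) l) ^ i)"
      using finB d by simp
    also have "\<dots> = of_bool (d = c) / of_nat (L c) *
          (\<Sum>i<L d. root_unity (L d) j ^ i * inverse (root_unity (L d) l) ^ i)
        - of_bool (j = 0) * of_bool (d = c0) / of_nat (L c0) *
          (\<Sum>i<L d. root_unity (L d) 0 ^ i * inverse (root_unity (L d) l) ^ i)"
      unfolding sum_distrib_left sum_subtractf[symmetric]
      by (intro sum.cong refl) (simp add: V_def left_diff_distrib)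
    also have "\<dots> = of_bool (c = d \<and> j = l) - of_bool (j = 0 \<and> d = c0 \<and> l = 0)"
      unfolding sum_root_unity[OF d(3)]
      using c d root_unity_eq_iff[of 0 "L d" l] root_unity_eq_iff[of j "L d" l] by auto
    finally show ?thesis .
  qed
  show thesis
  proof (rule that[of I \<iota> \<mu> "\<lambda>i x. V i (\<pi> x)" "\<lambda>i x. W i (\<pi> x)"])
    show "finite I" using finJ by (simp add: I_def)
    show "card I = n - 1" using cardJ finJ c0 L(1)[OF c0] by (simp add: I_def)
    show "\<iota> x \<in> I" "\<iota> (\<iota> x) = x" "\<mu> x * \<mu> (\<iota> x) = 1" if "x \<in> I" for x
      using that root_unity_add[of "L (fst x)" "snd x" "L (fst x) - snd x", symmetric]
      by (auto simp: I_def \<iota>_def \<mu>_def root_unity_self split: if_splits)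
    show "(\<Sum>x\<in>{1..n}. V i (\<pi> x)) = 0" if "i \<in> I" for i
    proof -
      obtain c j where i: "i = (c, j)" by (cases i)
      have cj: "c \<in> B" "j < L c" using that i by (auto simp: I_def)
      \<comment> \<open>The functions \<open>W (d, 0)\<close> are the indicators of the cycles and
        add up to 1, so the sum of \<open>V\<close> becomes a sum of pairings. This uses
        \<open>pair\<close> at the excluded index \<open>(c0, 0)\<close> too.\<close>
      have "(\<Sum>x\<in>{1..n}. V i (\<pi> x)) = (\<Sum>d\<in>B. \<Sum>x\<in>{1..n}. V (c, j) (\<pi> x) * W (d, 0) (\<pi> x))"
        unfolding i
      proof (subst sum.swap, rule sum.cong[OF refl])
        fix x assume x: "x \<in> {1..n}"
        have "(\<Sum>d\<in>B. V (c, j) (\<pi> x) * W (d, 0) (\<pi> x)) = (\<Sum>d\<in>B. if d = fst (\<pi> x) then V (c, j) (\<pi> x) else 0)"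
          by (intro sum.cong) (auto simp: W_def split: prod.split)
        then show "V (c, j) (\<pi> x) = (\<Sum>d\<in>B. V (c, j) (\<pi> x) * W (d, 0) (\<pi> x))"
          using finB \<pi>B[OF x] by simp
      qed
      also have "\<dots> = (\<Sum>d\<in>B. of_bool (c = d \<and> j = 0) - of_bool (j = 0 \<and> d = c0 \<and> 0 = (0::nat)))"
        using cj L(1) by (intro sum.cong pair) auto
      also have "\<dots> = (\<Sum>d\<in>B. if d = c then of_bool (j = 0) else 0) - (\<Sum>d\<in>B. if d = c0 then of_bool (j = 0) else 0)"
        unfolding sum_subtractf[symmetric] by (intro sum.cong) auto
      also have "\<dots> = 0" using finB cj c0 by simp
      finally show ?thesis .
    qed
    show "V i (\<pi> (g x)) = \<mu> i * V i (\<pi> x)" if "i \<in> I" "x \<in> {1..n}" for i x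
      using that(1) \<pi>g[OF that(2)] \<pi>B[OF that(2)] L(1)
      by (auto simp: V_def \<mu>_def I_def root_unity_power_mod right_diff_distrib split: prod.split)
    show "(\<Sum>x\<in>{1..n}. V i (\<pi> x) * W j (\<pi> x)) = (if i = j then 1 else 0)" if "i \<in> I" "j \<in> I" for i j
      using that pair[of "fst i" "snd i" "fst j" "snd j"] by (auto simp: I_def)
    show "(\<exists>z\<in>I. \<iota> z = z \<and> \<mu> z = 1) \<or> (\<exists>c. I = {c} \<times> {1..<n} \<and> (\<forall>j. \<mu> (c, j) = root_unity n j))"
    \<comment> \<open>A single cycle has length n and keeps its exponents 1, ..., n - 1; any further
      cycle contributes an invariant vector.\<close>
    proof (cases "B = {c0}")
      case True
      then have "L c0 = n" using cardJ by simp
      then have "I = {c0} \<times> {1..<n}" "\<forall>j. \<mu> (c0, j) = root_unity n j"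
        using True by (auto simp: I_def \<mu>_def)
      then show ?thesis by blast
    next
      case False
      then obtain c where "c \<in> B" "c \<noteq> c0" using c0 by blast
      then have "(c, 0) \<in> I" "\<iota> (c, 0) = (c, 0)" "\<mu> (c, 0) = 1"
        using L(1) by (auto simp: I_def \<iota>_def \<mu>_def)
      then show ?thesis by blast
    qed
  qed
qed

lemma exists_invariant_alternating:
  assumes g: "g permutes {1..n}" and n: "n \<ge> 1"
    and k: "even k \<and> k + 2 \<le> n \<or> odd k \<and> 3 \<le> k \<and> k + 3 \<le> n"
  obtains \<phi> b where "alternating n k \<phi>" "b ` {1..k} \<subseteq> {1..n}" "\<phi> b \<noteq> 0"
    "\<And>b. b ` {1..k} \<subseteq> {1..n} \<Longrightarrow> \<phi> (g \<circ> b) = \<phi> b"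
proof (rule eigenvectors[OF g n])
  fix I :: "(nat \<times> nat) set" and \<iota> \<mu> v w
  assume I: "finite I" "card I = n - 1" "\<And>x. x \<in> I \<Longrightarrow> \<iota> x \<in> I" "\<And>x. x \<in> I \<Longrightarrow> \<iota> (\<iota> x) = x"
    "\<And>x. x \<in> I \<Longrightarrow> \<mu> x * \<mu> (\<iota> x) = (1::complex)"
    and v0: "\<And>i. i \<in> I \<Longrightarrow> (\<Sum>x\<in>{1..n}. v i x) = 0"
    and vg: "\<And>i x. i \<in> I \<Longrightarrow> x \<in> {1..n} \<Longrightarrow> v i (g x) = \<mu> i * v i x"
    and vw: "\<And>i j. i \<in> I \<Longrightarrow> j \<in> I \<Longrightarrow> (\<Sum>x\<in>{1..n}. v i x * w j x) = (if i = j then 1 else 0)"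
    and alt: "(\<exists>z\<in>I. \<iota> z = z \<and> \<mu> z = 1) \<or> (\<exists>c. I = {c} \<times> {1..<n} \<and> (\<forall>j. \<mu> (c, j) = root_unity n j))"
  have "\<exists>K\<subseteq>I. card K = k \<and> (\<Prod>x\<in>K. \<mu> x) = 1"
  proof (cases "even k")
    case True
    then obtain m where m: "k = 2 * m" by (rule evenE)
    show ?thesis unfolding m
      by (rule even_subset_prod_1[where \<iota> = \<iota>]) (use I k m in auto)
  next
    case False
    then obtain m where m: "k = 2 * m + 1" by (rule oddE)
    from alt show ?thesis
    proof
      assume "\<exists>z\<in>I. \<iota> z = z \<and> \<mu> z = 1"
      then obtain z where z: "z \<in> I" "\<iota> z = z" "\<mu> z = 1" by blast
      show ?thesis unfolding m
        by (rule odd_subset_prod_1[where \<iota> = \<iota> and z = z]) (use I z k m in auto)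
    next
      assume "\<exists>c. I = {c} \<times> {1..<n} \<and> (\<forall>j. \<mu> (c, j) = root_unity n j)"
      then obtain c where c: "I = {c} \<times> {1..<n}" "\<And>j. \<mu> (c, j) = root_unity n j" by blast
      obtain K where K: "K \<subseteq> {1..<n}" "card K = k" "(\<Prod>j\<in>K. root_unity n j) = 1"
        using odd_subset_prod_1_cycle[of k n] k False by auto
      have "card (Pair c ` K) = k" "(\<Prod>x\<in>Pair c ` K. \<mu> x) = 1"
        using K(2,3) by (simp_all add: card_image prod.reindex c(2) inj_on_def)
      then show ?thesis using K(1) c(1) by (intro exI[of _ "Pair c ` K"]) auto
    qed
  qed
  then obtain K where K: "K \<subseteq> I" "card K = k" "(\<Prod>x\<in>K. \<mu> x) = 1" by blast
  have "finite K" using K(1) I(1) finite_subset by blast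
  then obtain \<kappa> where \<kappa>: "bij_betw \<kappa> {1..k} K"
    using finite_same_card_bij[of "{1..k}" K] K(2) by auto
  have \<kappa>I: "\<kappa> i \<in> I" if "i \<in> {1..k}" for i using bij_betwE[OF \<kappa>] K(1) that by blast
  have inj: "\<kappa> i = \<kappa> j \<longleftrightarrow> i = j" if "i \<in> {1..k}" "j \<in> {1..k}" for i j
    using bij_betw_imp_inj_on[OF \<kappa>] that by (rule inj_on_eq_iff)
  let ?\<phi> = "wedge k (\<lambda>i. v (\<kappa> i))"
  obtain b where b: "b \<in> {1..k} \<rightarrow>\<^sub>E {1..n}" "?\<phi> b \<noteq> 0"
  proof -
    have "\<exists>b\<in>{1..k} \<rightarrow>\<^sub>E {1..n}. ?\<phi> b \<noteq> 0"
      by (rule wedge_neq_0[where w = "\<lambda>i. w (\<kappa> i)"]) (simp add: vw \<kappa>I inj)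
    then show ?thesis using that by blast
  qed
  show thesis
  proof (rule that)
    show "alternating n k ?\<phi>" by (intro alternating_wedge v0 \<kappa>I)
    show "b ` {1..k} \<subseteq> {1..n}" using b(1) by blast
    show "?\<phi> b \<noteq> 0" by fact
    fix b :: "nat \<Rightarrow> nat" assume b: "b ` {1..k} \<subseteq> {1..n}"
    have "?\<phi> (g \<circ> b) = (\<Prod>i\<in>{1..k}. \<mu> (\<kappa> i)) * ?\<phi> b"
      by (rule wedge_comp[OF _ b]) (simp add: vg \<kappa>I)
    then show "?\<phi> (g \<circ> b) = ?\<phi> b"
      using prod.reindex_bij_betw[OF \<kappa>, of \<mu>] K(3) by simp
  qed
qed

section \<open>Specht modules of hooks\<close>

text \<open>The column stabilizer permutes entries, whereas \<open>boundary\<close> permutes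
  positions; this passes from one sum to the other.\<close>

lemma sum_permutes_image:
  assumes a: "inj_on a S"
  shows "(\<Sum>p | p permutes a ` S. F p) = (\<Sum>\<sigma> | \<sigma> permutes S. F (map_permutation S a \<sigma>))"
proof (rule sum.reindex_bij_witness[where i = "map_permutation S a"
      and j = "map_permutation (a ` S) (inv_into S a)"])
  have bij: "bij_betw a S (a ` S)" using a by (simp add: bij_betw_def)
  have bij': "bij_betw (inv_into S a) (a ` S) S" using bij by (rule bij_betw_inv_into)
  fix p assume "p \<in> {p. p permutes a ` S}"
  then have p: "p permutes a ` S" by simp
  show E: "map_permutation S a (map_permutation (a ` S) (inv_into S a) p) = p"
    by (rule map_permutation_compose_inv[OF bij' p]) (rule f_inv_into_f)
  show "map_permutation (a ` S) (inv_into S a) p \<in> {\<sigma>. \<sigma> permutes S}"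
    using map_permutation_permutes[OF bij' p] by simp
  show "F (map_permutation S a (map_permutation (a ` S) (inv_into S a) p)) = F p" unfolding E ..
next
  have bij: "bij_betw a S (a ` S)" using a by (simp add: bij_betw_def)
  fix \<sigma> assume "\<sigma> \<in> {\<sigma>. \<sigma> permutes S}"
  then have \<sigma>: "\<sigma> permutes S" by simp
  show "map_permutation (a ` S) (inv_into S a) (map_permutation S a \<sigma>) = \<sigma>"
    by (rule map_permutation_compose_inv[OF bij \<sigma>]) (rule inv_into_f_f[OF a])
  show "map_permutation S a \<sigma> \<in> {p. p permutes a ` S}"
    using map_permutation_permutes[OF bij \<sigma>] by simp
qed

text \<open>A tabloid of hook shape is determined by the entries in column 0 of the rows \<open>1, \<dots>, k\<close>,
  so the choice of a representative is immaterial once \<open>\<phi>\<close> depends only on these.\<close>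

definition tabloid_lift :: "nat list \<Rightarrow> ((nat \<Rightarrow> nat) \<Rightarrow> complex) \<Rightarrow> tabloid_fun" where
  "tabloid_lift lam \<phi> U =
    (if U \<in> tabloid lam ` tableaux lam then \<phi> (\<lambda>i. (SOME t. t \<in> U) (i, 0)) else 0)"

lemma perm_act_tabloid:
  "g permutes {1..sum_list lam} \<Longrightarrow>
    perm_act g f (tabloid lam t) = f (tabloid lam (Hilbert_Choice.inv g \<circ> t))"
  by (simp add: perm_act_def tabloid_act[OF permutes_inv])

lemma perm_act_not_tabloid:
  assumes g: "g permutes {1..sum_list lam}" and U: "U \<notin> tabloid lam ` tableaux lam"
    and f: "\<And>U. U \<notin> tabloid lam ` tableaux lam \<Longrightarrow> f U = 0"
  shows "perm_act g f U = 0"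
  unfolding perm_act_def
proof (rule f, rule notI)
  let ?h = "Hilbert_Choice.inv g"
  assume "(\<lambda>t. ?h \<circ> t) ` U \<in> tabloid lam ` tableaux lam"
  then obtain t where t: "t \<in> tableaux lam" "(\<lambda>t. ?h \<circ> t) ` U = tabloid lam t" by blast
  then have "(\<lambda>t. g \<circ> t) ` (\<lambda>t. ?h \<circ> t) ` U = tabloid lam (g \<circ> t)"
    by (simp add: tabloid_act[OF g])
  moreover have "(\<lambda>t. g \<circ> t) ` (\<lambda>t. ?h \<circ> t) ` U = U"
    by (simp add: image_image comp_assoc[symmetric] permutes_inv_o[OF g])
  ultimately show False using U perm_tableau[OF g t(1)] by auto
qed

lemma sum_fun_scale_apply: "(\<Sum>i\<in>A. fun_scale (c i) (f i)) x = (\<Sum>i\<in>A. c i * f i x)"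
  by (induction A rule: infinite_finite_induct) (simp_all add: fun_scale_def)

lemma atLeast0_atMost_insert: "{0..k::nat} = insert 0 {1..k}"
  by auto

lemma inj_on_fun_upd_0:
  assumes "inj_on b {1..k::nat}" "x \<notin> b ` {1..k}"
  shows "inj_on (b(0 := x)) {0..k}"
  unfolding atLeast0_atMost_insert using assms by (simp add: inj_on_fun_updI fun_upd_image)

section \<open>Tableaux and tabloids of hook shape\<close>

locale hook =
  fixes n k :: nat and lam :: "nat list"
  assumes k: "1 \<le> k" "k < n" and lam: "lam = (n - k) # replicate k 1"
begin

lemma sum_list_lam: "sum_list lam = n"
  using k by (simp add: lam sum_list_replicate)

lemma diagram_lam: "diagram lam = {0} \<times> {..<n - k} \<union> {1..k} \<times> {0}"
proof -
  have *: "i < length lam \<and> j < lam ! i \<longleftrightarrow> i = 0 \<and> j < n - k \<or> 1 \<le> i \<and> i \<le> k \<and> j = 0" for i j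
    by (cases i) (auto simp: lam One_nat_def)
  show ?thesis unfolding diagram_def * by auto
qed

text \<open>The split along the first column, suited to column stabilizers;
  \<open>diagram_lam\<close> splits along the first row, suited to tabloids.\<close>

lemma diagram_lam': "diagram lam = {0..k} \<times> {0} \<union> {0} \<times> {1..<n - k}"
proof -
  have "i = 0 \<and> j < n - k \<or> 1 \<le> i \<and> i \<le> k \<and> j = 0 \<longleftrightarrow>
      0 \<le> i \<and> i \<le> k \<and> j = 0 \<or> i = 0 \<and> 1 \<le> j \<and> j < n - k" for i j
    using k by (cases i; cases j) auto
  then show ?thesis unfolding diagram_lam by (auto simp: set_eq_iff)
qed

lemma tableau_bij: "t \<in> tableaux lam \<Longrightarrow> bij_betw t (diagram lam) {1..n}"
  by (simp add: tableaux_def sum_list_lam)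

lemma tableau_inj_on: "t \<in> tableaux lam \<Longrightarrow> inj_on (\<lambda>i. t (i, 0)) {0..k}"
  using bij_betw_imp_inj_on[OF tableau_bij, of t] by (auto simp: inj_on_def diagram_lam')

lemma tableau_in: "t \<in> tableaux lam \<Longrightarrow> i \<in> {0..k} \<Longrightarrow> t (i, 0) \<in> {1..n}"
  using bij_betwE[OF tableau_bij, of t] by (auto simp: diagram_lam')

lemma ex_tableau:
  assumes a: "inj_on a {0..k}" "a ` {0..k} \<subseteq> {1..n}"
  shows "\<exists>t\<in>tableaux lam. \<forall>i\<in>{0..k}. t (i, 0) = a i"
proof -
  have "card ({1..n} - a ` {0..k}) = n - (k + 1)"
    using a by (subst card_Diff_subset) (auto simp: card_image)
  then obtain h where h: "bij_betw h ({0::nat} \<times> {1..<n - k}) ({1..n} - a ` {0..k})"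
    using finite_same_card_bij[of "{0::nat} \<times> {1..<n - k}" "{1..n} - a ` {0..k}"] by auto
  define t where "t = (\<lambda>(i, j). if i \<le> k \<and> j = 0 then a i
    else if (i, j) \<in> diagram lam then h (i, j) else 0)"
  have "bij_betw t ({0..k} \<times> {0}) (a ` {0..k})"
    using a(1) by (intro bij_betw_imageI) (force simp: t_def inj_on_def image_iff)+
  moreover have "bij_betw t ({0} \<times> {1..<n - k}) ({1..n} - a ` {0..k})"
    using h by (rule bij_betw_cong[THEN iffD1, rotated]) (auto simp: t_def diagram_lam')
  ultimately have "bij_betw t (diagram lam) (a ` {0..k} \<union> ({1..n} - a ` {0..k}))"
    unfolding diagram_lam' by (rule bij_betw_combine) auto
  moreover have "a ` {0..k} \<union> ({1..n} - a ` {0..k}) = {1..n}" using a(2) by blast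
  moreover have "t c = 0" if "c \<notin> diagram lam" for c
    using that by (cases c) (auto simp: t_def diagram_lam')
  ultimately have "t \<in> tableaux lam" by (simp add: tableaux_def sum_list_lam)
  then show ?thesis by (intro bexI[of _ t]) (auto simp: t_def)
qed

text \<open>As k < n, some entry is left over for the corner of the hook.\<close>

lemma ex_tableau':
  assumes b: "inj_on b {1..k}" "b ` {1..k} \<subseteq> {1..n}"
  shows "\<exists>t\<in>tableaux lam. \<forall>i\<in>{1..k}. t (i, 0) = b i"
proof -
  have "card (b ` {1..k}) < card {1..n}" using k b(1) by (simp add: card_image)
  then have "\<not> {1..n} \<subseteq> b ` {1..k}"
    using card_mono[of "b ` {1..k}" "{1..n}"] by auto
  then obtain x where x: "x \<in> {1..n}" "x \<notin> b ` {1..k}" by blast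
  have "inj_on (b(0 := x)) {0..k}" by (rule inj_on_fun_upd_0[OF b(1) x(2)])
  moreover have "(b(0 := x)) ` {0..k} \<subseteq> {1..n}"
    using b(2) x(1) by (fastforce simp: atLeast0_atMost_insert)
  ultimately have "inj_on (b(0 := x)) {0..k}" "(b(0 := x)) ` {0..k} \<subseteq> {1..n}" by blast+
  from ex_tableau[OF this] obtain t where t: "t \<in> tableaux lam" "\<forall>i\<in>{0..k}. t (i, 0) = (b(0 := x)) i"
    by blast
  then show ?thesis by (intro bexI[of _ t]) auto
qed

lemma row_lam:
  assumes t: "t \<in> tableaux lam"
  shows "row lam t i = (if i = 0 then {1..n} - (\<lambda>i. t (i, 0)) ` {1..k} else if i \<le> k then {t (i, 0)} else {})"
proof (cases "i = 0")
  case True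
  have "t ` ({0} \<times> {..<n - k}) = t ` (diagram lam - {1..k} \<times> {0})"
    by (rule arg_cong[where f = "image t"]) (auto simp: diagram_lam)
  also have "\<dots> = {1..n} - (\<lambda>i. t (i, 0)) ` {1..k}"
    using inj_on_image_set_diff[OF bij_betw_imp_inj_on[OF tableau_bij[OF t]], of "diagram lam" "{1..k} \<times> {0}"]
      bij_betw_imp_surj_on[OF tableau_bij[OF t]]
    by (auto simp: diagram_lam)
  finally have "t ` ({0} \<times> {..<n - k}) = {1..n} - (\<lambda>i. t (i, 0)) ` {1..k}" .
  moreover have "{c \<in> diagram lam. fst c = 0} = {0} \<times> {..<n - k}" by (auto simp: diagram_lam)
  ultimately show ?thesis using True by (simp add: row_def)
next
  case False
  then have "{c \<in> diagram lam. fst c = i} = (if i \<le> k then {(i, 0)} else {})"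
    by (auto simp: diagram_lam)
  then show ?thesis using False by (simp add: row_def)
qed

lemma tabloid_eq_iff:
  assumes s: "s \<in> tableaux lam" and t: "t \<in> tableaux lam"
  shows "tabloid lam s = tabloid lam t \<longleftrightarrow> (\<forall>i\<in>{1..k}. s (i, 0) = t (i, 0))"
proof
  assume "tabloid lam s = tabloid lam t"
  moreover have "s \<in> tabloid lam s" using s by (simp add: tabloid_def)
  ultimately have "row lam s i = row lam t i" for i by (simp add: tabloid_def)
  then show "\<forall>i\<in>{1..k}. s (i, 0) = t (i, 0)"
    unfolding row_lam[OF s] row_lam[OF t] by (metis atLeastAtMost_iff not_one_le_zero singleton_inject)
next
  assume *: "\<forall>i\<in>{1..k}. s (i, 0) = t (i, 0)"
  then have "(\<lambda>i. s (i, 0)) ` {1..k} = (\<lambda>i. t (i, 0)) ` {1..k}" by (intro image_cong) auto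
  then have "row lam s i = row lam t i" for i
    using * unfolding row_lam[OF s] row_lam[OF t] by auto
  then show "tabloid lam s = tabloid lam t" by (simp add: tabloid_def)
qed

lemma tabloid_lift_tabloid:
  assumes t: "t \<in> tableaux lam" and \<phi>: "\<And>b b'. (\<And>j. j \<in> {1..k} \<Longrightarrow> b j = b' j) \<Longrightarrow> \<phi> b = \<phi> b'"
  shows "tabloid_lift lam \<phi> (tabloid lam t) = \<phi> (\<lambda>i. t (i, 0))"
proof -
  define s where "s = (SOME s. s \<in> tabloid lam t)"
  have "t \<in> tabloid lam t" using t by (simp add: tabloid_def)
  then have s: "s \<in> tabloid lam t" unfolding s_def by (rule someI[of "\<lambda>s. s \<in> tabloid lam t"])
  then have "s \<in> tableaux lam" "tabloid lam s = tabloid lam t" by (auto simp: tabloid_def)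
  then have "\<forall>i\<in>{1..k}. s (i, 0) = t (i, 0)" using tabloid_eq_iff[OF _ t] by blast
  then have "\<phi> (\<lambda>i. s (i, 0)) = \<phi> (\<lambda>i. t (i, 0))" by (intro \<phi>) blast
  then show ?thesis using t by (simp add: tabloid_lift_def s_def)
qed

text \<open>Every column other than the first has at most one cell, so its entry must be
  fixed.\<close>

lemma column_stabilizer_lam:
  assumes t: "t \<in> tableaux lam"
  shows "column_stabilizer lam t = {p. p permutes (\<lambda>i. t (i, 0)) ` {0..k}}"
proof -
  let ?A = "(\<lambda>i. t (i, 0)) ` {0..k}"
  have A: "?A \<subseteq> {1..n}" using tableau_in[OF t] by blast
  have col0: "column lam t 0 = ?A"
  proof -
    have "{c \<in> diagram lam. snd c = 0} = (\<lambda>i. (i, 0)) ` {0..k}" by (auto simp: diagram_lam')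
    then show ?thesis by (simp add: column_def image_image)
  qed
  have colj: "column lam t j = (if j < n - k then {t (0, j)} else {})" if "j \<noteq> 0" for j
  proof -
    have "{c \<in> diagram lam. snd c = j} = (if j < n - k then {(0, j)} else {})"
      using that by (auto simp: diagram_lam')
    then show ?thesis by (simp add: column_def)
  qed
  have tA: "t (0, j) \<notin> ?A" if "j \<noteq> 0" "j < n - k" for j
    using bij_betw_imp_inj_on[OF tableau_bij[OF t]] that
    by (auto simp: diagram_lam' inj_on_def)
  show ?thesis
  proof (intro equalityI subsetI)
    fix p assume "p \<in> column_stabilizer lam t"
    then have p: "p permutes {1..n}" "\<And>j. p ` column lam t j = column lam t j"
      by (auto simp: column_stabilizer_def sum_list_lam)
    have "p x = x" if x: "x \<in> {1..n} - ?A" for x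
    proof -
      have "x \<in> t ` diagram lam" using bij_betw_imp_surj_on[OF tableau_bij[OF t]] x by simp
      then obtain c where c: "c \<in> diagram lam" "x = t c" by blast
      have "c \<notin> {0..k} \<times> {0}" using c x by auto
      then obtain j where "c = (0, j)" "j \<in> {1..<n - k}" using c(1) unfolding diagram_lam' by blast
      then show "p x = x" using p(2)[of j] c(2) by (simp add: colj)
    qed
    then have "p x = x" if "x \<notin> ?A" for x
      using that permutes_not_in[OF p(1), of x] by (cases "x \<in> {1..n}") simp_all
    moreover have "inj_on p ?A" using permutes_inj[OF p(1)] by (rule inj_on_subset) simp
    ultimately show "p \<in> {p. p permutes ?A}"
      using p(2)[of 0] by (auto intro!: bij_imp_permutes simp: bij_betw_def col0)
  next
    fix p assume "p \<in> {p. p permutes ?A}"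
    then have p: "p permutes ?A" by simp
    have "p permutes {1..n}" using p A by (rule permutes_subset)
    moreover have "p ` column lam t j = column lam t j" for j
    proof (cases "j = 0")
      case True
      then show ?thesis using permutes_image[OF p] by (simp add: col0)
    next
      case False
      then show ?thesis using permutes_not_in[OF p tA] by (simp add: colj)
    qed
    ultimately show "p \<in> column_stabilizer lam t"
      by (simp add: column_stabilizer_def sum_list_lam)
  qed
qed

section \<open>Polytabloids as boundaries, the Specht module as alternating functions\<close>

lemma boundary_cong: "(\<And>j. j \<in> {1..k} \<Longrightarrow> b j = b' j) \<Longrightarrow> boundary k a b = boundary k a b'"
  by (simp add: boundary_def)

text \<open>The column stabilizer is the full symmetric group on the k + 1 entries of the first
  column, and passing to tabloids forgets the corner entry, just as a face omits a vertex.\<close>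

lemma polytabloid_eq_lift:
  assumes t: "t \<in> tableaux lam"
  shows "polytabloid lam t = tabloid_lift lam (boundary k (\<lambda>i. t (i, 0)))"
proof
  fix U
  let ?a = "\<lambda>i. t (i, 0)"
  have cs: "p permutes {1..sum_list lam}" if "p \<in> column_stabilizer lam t" for p
    using that by (simp add: column_stabilizer_def)
  show "polytabloid lam t U = tabloid_lift lam (boundary k ?a) U"
  proof (cases "U \<in> tabloid lam ` tableaux lam")
    case False
    then have "polytabloid lam t U = 0"
      unfolding polytabloid_def using perm_tableau[OF cs t] by (intro sum.neutral) auto
    then show ?thesis using False by (simp add: tabloid_lift_def)
  next
    case True
    then obtain s where s: "s \<in> tableaux lam" "U = tabloid lam s" by blast
    have inj: "inj_on ?a {0..k}" by (rule tableau_inj_on[OF t])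
    have "polytabloid lam t U = (\<Sum>p\<in>column_stabilizer lam t.
        of_int (sign p) * of_bool (\<forall>j\<in>{1..k}. s (j, 0) = p (?a j)))"
      unfolding polytabloid_def s(2)
      by (intro sum.cong refl) (simp add: tabloid_eq_iff[OF s(1) perm_tableau[OF cs t]])
    also have "\<dots> = (\<Sum>\<sigma> | \<sigma> permutes {0..k}. of_int (sign (map_permutation {0..k} ?a \<sigma>)) *
        of_bool (\<forall>j\<in>{1..k}. s (j, 0) = map_permutation {0..k} ?a \<sigma> (?a j)))"
      unfolding column_stabilizer_lam[OF t] by (rule sum_permutes_image[OF inj])
    also have "\<dots> = boundary k ?a (\<lambda>i. s (i, 0))"
      unfolding boundary_def
    proof (intro sum.cong refl arg_cong2[of _ _ _ _ "(*)"])
      fix \<sigma> assume "\<sigma> \<in> {\<sigma>. \<sigma> permutes {0..k}}"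
      then show "complex_of_int (sign (map_permutation {0..k} ?a \<sigma>)) = of_int (sign \<sigma>)"
        using sign_map_permutation[OF inj, of \<sigma>] by simp
      have "map_permutation {0..k} ?a \<sigma> (?a j) = ?a (\<sigma> j)" if "j \<in> {1..k}" for j
        using that by (intro map_permutation_apply[OF inj]) simp
      then show "of_bool (\<forall>j\<in>{1..k}. s (j, 0) = map_permutation {0..k} ?a \<sigma> (?a j)) =
          (of_bool (\<forall>j\<in>{1..k}. s (j, 0) = ?a (\<sigma> j)) :: complex)"
        by simp
    qed
    also have "\<dots> = tabloid_lift lam (boundary k ?a) U"
      unfolding s(2) by (rule tabloid_lift_tabloid[OF s(1) boundary_cong, symmetric])
    finally show ?thesis .
  qed
qed

lemma tabloid_lift_add:
  "tabloid_lift lam (\<lambda>b. \<phi> b + \<psi> b) = tabloid_lift lam \<phi> + tabloid_lift lam \<psi>"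
  by (simp add: tabloid_lift_def fun_eq_iff)

lemma tabloid_lift_scale:
  "tabloid_lift lam (\<lambda>b. c * \<phi> b) = fun_scale c (tabloid_lift lam \<phi>)"
  by (simp add: tabloid_lift_def fun_eq_iff fun_scale_def)

lemma specht_imp_lift:
  assumes "f \<in> specht lam"
  shows "\<exists>\<phi>. alternating n k \<phi> \<and> f = tabloid_lift lam \<phi>"
proof -
  have "f \<in> fun_vs.span (polytabloid lam ` tableaux lam)" using assms by (simp add: specht_def)
  then show ?thesis
  proof (induction rule: fun_vs.span_induct_alt)
    case base
    have "tabloid_lift lam (\<lambda>_. 0) = 0" by (simp add: tabloid_lift_def fun_eq_iff)
    then show ?case using alternating_zero by metis
  next
    case (step c x y)
    then obtain t \<psi> where t: "t \<in> tableaux lam" "x = polytabloid lam t"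
      and \<psi>: "alternating n k \<psi>" "y = tabloid_lift lam \<psi>" by blast
    let ?\<phi> = "boundary k (\<lambda>i. t (i, 0))"
    have "alternating n k ?\<phi>" using tableau_in[OF t(1)] by (intro alternating_boundary) blast
    then have "alternating n k (\<lambda>b. c * ?\<phi> b + \<psi> b)" by (intro alternating_add alternating_scale \<psi>)
    moreover have "fun_scale c x + y = tabloid_lift lam (\<lambda>b. c * ?\<phi> b + \<psi> b)"
      by (simp add: tabloid_lift_add tabloid_lift_scale t \<psi> polytabloid_eq_lift)
    ultimately show ?case by blast
  qed
qed

text \<open>\<open>alternating_eq_boundaries\<close> writes \<open>\<phi>\<close> through cones with
  apex 1. For injective \<open>c\<close> the cone is the polytabloid of a tableau with corner entry
  1; for other \<open>c\<close> the coefficient \<open>\<phi> c\<close> is 0.\<close>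

lemma lift_in_specht:
  assumes \<phi>: "alternating n k \<phi>"
  shows "tabloid_lift lam \<phi> \<in> specht lam"
proof -
  let ?C = "{1..k} \<rightarrow>\<^sub>E {2..n}"
  let ?L = "\<lambda>c. tabloid_lift lam (boundary k (c(0 := 1)))"
  have "fun_scale (\<phi> c) (?L c) \<in> specht lam" if c: "c \<in> ?C" for c
  proof (cases "inj_on c {1..k}")
    case False
    then have "fun_scale (\<phi> c) (?L c) = 0"
      using alternating_not_inj[OF \<phi>] by (simp add: fun_scale_def fun_eq_iff)
    then show ?thesis unfolding specht_def by (simp only: fun_vs.span_zero)
  next
    case True
    have c2: "c i \<in> {2..n}" if "i \<in> {1..k}" for i using c that by (rule PiE_mem)
    have "1 \<notin> c ` {1..k}" using c2 by fastforce
    then have "inj_on (c(0 := 1)) {0..k}" by (rule inj_on_fun_upd_0[OF True])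
    moreover have "(c(0 := 1)) ` {0..k} \<subseteq> {1..n}"
    proof (rule image_subsetI)
      fix i assume "i \<in> {0..k}"
      then show "(c(0 := 1)) i \<in> {1..n}" using c2[of i] k by (cases "i = 0") auto
    qed
    ultimately obtain t where t: "t \<in> tableaux lam" "\<forall>i\<in>{0..k}. t (i, 0) = (c(0 := 1)) i"
      using ex_tableau by blast
    have "boundary k (\<lambda>i. t (i, 0)) = boundary k (c(0 := 1))"
      unfolding boundary_def
    proof (intro ext sum.cong refl arg_cong2[of _ _ _ _ "(*)"])
      fix b \<sigma> assume "\<sigma> \<in> {\<sigma>. \<sigma> permutes {0..k}}"
      then have "\<sigma> j \<in> {0..k}" if "j \<in> {1..k}" for j
        using that permutes_in_image[of \<sigma> "{0..k}" j] by simp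
      then have "t (\<sigma> j, 0) = (c(0 := 1)) (\<sigma> j)" if "j \<in> {1..k}" for j
        using t(2) that by blast
      then have "(\<forall>j\<in>{1..k}. b j = t (\<sigma> j, 0)) \<longleftrightarrow> (\<forall>j\<in>{1..k}. b j = (c(0 := 1)) (\<sigma> j))"
        by (intro ball_cong refl) (simp only:)
      then show "of_bool (\<forall>j\<in>{1..k}. b j = t (\<sigma> j, 0)) =
          (of_bool (\<forall>j\<in>{1..k}. b j = (c(0 := 1)) (\<sigma> j)) :: complex)"
        by (simp only:)
    qed
    then have "?L c = polytabloid lam t" by (simp add: polytabloid_eq_lift[OF t(1)])
    then show ?thesis
      unfolding specht_def using t(1) by (simp add: fun_vs.span_scale fun_vs.span_base)
  qed
  then have S: "(\<Sum>c\<in>?C. fun_scale (\<phi> c) (?L c)) \<in> specht lam"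
    unfolding specht_def by (intro fun_vs.span_sum)
  have "tabloid_lift lam \<phi> = fun_scale (1 / fact k) (\<Sum>c\<in>?C. fun_scale (\<phi> c) (?L c))"
  proof
    fix U
    have sum: "(\<Sum>c\<in>?C. fun_scale (\<phi> c) (?L c)) U = (\<Sum>c\<in>?C. \<phi> c * ?L c U)"
      by (rule sum_fun_scale_apply)
    show "tabloid_lift lam \<phi> U = fun_scale (1 / fact k) (\<Sum>c\<in>?C. fun_scale (\<phi> c) (?L c)) U"
    proof (cases "U \<in> tabloid lam ` tableaux lam")
      case True
      then obtain s where s: "s \<in> tableaux lam" "U = tabloid lam s" by blast
      let ?b = "\<lambda>i. s (i, 0)"
      have "?b ` {1..k} \<subseteq> {1..n}" using tableau_in[OF s(1)] by auto
      then have "fact k * \<phi> ?b = (\<Sum>c\<in>?C. \<phi> c * boundary k (c(0 := 1)) ?b)"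
        using k by (intro alternating_eq_boundaries[OF \<phi>]) auto
      moreover have "tabloid_lift lam \<phi> U = \<phi> ?b"
        unfolding s(2) by (rule tabloid_lift_tabloid[OF s(1) alternating_cong[OF \<phi>]])
      moreover have "?L c U = boundary k (c(0 := 1)) ?b" for c
        unfolding s(2) by (rule tabloid_lift_tabloid[OF s(1) boundary_cong])
      ultimately show ?thesis
        unfolding fun_scale_def[of "1 / fact k"] sum by (simp add: field_simps)
    next
      case False
      then show ?thesis unfolding fun_scale_def[of "1 / fact k"] sum by (simp add: tabloid_lift_def)
    qed
  qed
  then show ?thesis using S unfolding specht_def by (simp add: fun_vs.span_scale)
qed

text \<open>Acting by \<open>g\<close> precomposes coefficients with the inverse of
  \<open>g\<close>, and being fixed by either is the same. Lifting loses no information, since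
  tableaux realise all injective tuples and alternating functions vanish on the others.\<close>

theorem unisingular_hook_iff:
  "unisingular (sym_group n) fun_scale (specht lam) perm_act \<longleftrightarrow>
    (\<forall>g. g permutes {1..n} \<longrightarrow> (\<exists>\<phi> b. alternating n k \<phi> \<and> b ` {1..k} \<subseteq> {1..n} \<and> \<phi> b \<noteq> 0 \<and>
      (\<forall>b. b ` {1..k} \<subseteq> {1..n} \<longrightarrow> \<phi> (g \<circ> b) = \<phi> b)))"
  unfolding unisingular_specht_iff[OF sum_list_lam]
proof (intro iff_allI imp_cong refl iffI)
  fix g assume g: "g permutes {1..n}"
  then have g': "g permutes {1..sum_list lam}" by (simp add: sum_list_lam)
  let ?h = "Hilbert_Choice.inv g"
  have h': "?h permutes {1..sum_list lam}" using g' by (rule permutes_inv)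
  have gh: "?h (g x) = x" "g (?h x) = x" for x using permutes_inverses[OF g] by auto
  {
    assume "\<exists>f\<in>specht lam. f \<noteq> 0 \<and> perm_act g f = f"
    then obtain f where f: "f \<in> specht lam" "f \<noteq> 0" "perm_act g f = f" by blast
    obtain \<phi> where \<phi>: "alternating n k \<phi>" "f = tabloid_lift lam \<phi>"
      using specht_imp_lift[OF f(1)] by blast
    have lift: "tabloid_lift lam \<phi> (tabloid lam t) = \<phi> (\<lambda>i. t (i, 0))" if "t \<in> tableaux lam" for t
      by (rule tabloid_lift_tabloid[OF that alternating_cong[OF \<phi>(1)]])
    obtain U where U: "f U \<noteq> 0" using f(2) by (auto simp: fun_eq_iff)
    then have "U \<in> tabloid lam ` tableaux lam" by (auto simp: \<phi>(2) tabloid_lift_def split: if_splits)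
    then obtain t where t: "t \<in> tableaux lam" "U = tabloid lam t" by blast
    have "\<phi> (\<lambda>i. t (i, 0)) \<noteq> 0" using U lift[OF t(1)] by (simp add: \<phi>(2) t(2))
    moreover have "(\<lambda>i. t (i, 0)) ` {1..k} \<subseteq> {1..n}" using tableau_in[OF t(1)] by auto
    moreover have "\<phi> (g \<circ> b) = \<phi> b" if b: "b ` {1..k} \<subseteq> {1..n}" for b
    proof (cases "inj_on b {1..k}")
      case True
      obtain s where s: "s \<in> tableaux lam" "\<forall>i\<in>{1..k}. s (i, 0) = b i"
        using ex_tableau'[OF True b] by blast
      have gs: "g \<circ> s \<in> tableaux lam" by (rule perm_tableau[OF g' s(1)])
      have "?h \<circ> (g \<circ> s) = s" by (simp add: fun_eq_iff gh)
      then have "f (tabloid lam s) = f (tabloid lam (g \<circ> s))"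
        using perm_act_tabloid[OF g', of f "g \<circ> s"] f(3) by simp
      then have "\<phi> (\<lambda>i. s (i, 0)) = \<phi> (\<lambda>i. (g \<circ> s) (i, 0))"
        by (simp only: \<phi>(2) lift[OF s(1)] lift[OF gs])
      moreover have "\<phi> (\<lambda>i. s (i, 0)) = \<phi> b" by (rule alternating_cong[OF \<phi>(1)]) (use s(2) in blast)
      moreover have "\<phi> (\<lambda>i. (g \<circ> s) (i, 0)) = \<phi> (g \<circ> b)"
        by (rule alternating_cong[OF \<phi>(1)]) (simp add: s(2))
      ultimately show ?thesis by simp
    next
      case False
      \<comment> \<open>No tableau has such a column, but both values are 0 by antisymmetry.\<close>
      then have "\<not> inj_on (g \<circ> b) {1..k}" using inj_on_imageI2 by blast
      then show ?thesis using False alternating_not_inj[OF \<phi>(1)] by simp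
    qed
    ultimately show "\<exists>\<phi> b. alternating n k \<phi> \<and> b ` {1..k} \<subseteq> {1..n} \<and> \<phi> b \<noteq> 0 \<and>
      (\<forall>b. b ` {1..k} \<subseteq> {1..n} \<longrightarrow> \<phi> (g \<circ> b) = \<phi> b)"
      using \<phi>(1) by blast
  next
    assume "\<exists>\<phi> b. alternating n k \<phi> \<and> b ` {1..k} \<subseteq> {1..n} \<and> \<phi> b \<noteq> 0 \<and>
      (\<forall>b. b ` {1..k} \<subseteq> {1..n} \<longrightarrow> \<phi> (g \<circ> b) = \<phi> b)"
    then obtain \<phi> b where \<phi>: "alternating n k \<phi>" and b: "b ` {1..k} \<subseteq> {1..n}" "\<phi> b \<noteq> 0"
      and inv: "\<And>b. b ` {1..k} \<subseteq> {1..n} \<Longrightarrow> \<phi> (g \<circ> b) = \<phi> b" by blast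
    have lift: "tabloid_lift lam \<phi> (tabloid lam t) = \<phi> (\<lambda>i. t (i, 0))" if "t \<in> tableaux lam" for t
      by (rule tabloid_lift_tabloid[OF that alternating_cong[OF \<phi>]])
    let ?f = "tabloid_lift lam \<phi>"
    have "inj_on b {1..k}" using alternating_not_inj[OF \<phi>] b(2) by blast
    then obtain t where t: "t \<in> tableaux lam" "\<forall>i\<in>{1..k}. t (i, 0) = b i"
      using ex_tableau'[OF _ b(1)] by blast
    have "?f (tabloid lam t) = \<phi> b"
      unfolding lift[OF t(1)] by (rule alternating_cong[OF \<phi>]) (use t(2) in blast)
    then have "?f \<noteq> 0" using b(2) by auto
    moreover have "perm_act g ?f = ?f"
    proof
      fix U
      show "perm_act g ?f U = ?f U"
      proof (cases "U \<in> tabloid lam ` tableaux lam")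
        case True
        then obtain s where s: "s \<in> tableaux lam" "U = tabloid lam s" by blast
        have hs: "?h \<circ> s \<in> tableaux lam" by (rule perm_tableau[OF h' s(1)])
        have "(\<lambda>i. (?h \<circ> s) (i, 0)) ` {1..k} \<subseteq> {1..n}" using tableau_in[OF hs] by auto
        from inv[OF this] have "\<phi> (\<lambda>i. s (i, 0)) = \<phi> (\<lambda>i. (?h \<circ> s) (i, 0))"
          by (simp add: o_def gh)
        then show ?thesis
          unfolding s(2) perm_act_tabloid[OF g'] lift[OF hs] lift[OF s(1)] ..
      next
        case False
        then show ?thesis
          using perm_act_not_tabloid[OF g' False, of ?f] by (simp add: tabloid_lift_def)
      qed
    qed
    ultimately show "\<exists>f\<in>specht lam. f \<noteq> 0 \<and> perm_act g f = f"
      using lift_in_specht[OF \<phi>] by blast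
  }
qed

end

section \<open>Invariants of an n-cycle\<close>

text \<open>Isolates the argument to which a sum condition is to be applied.\<close>

lemma sum_PiE_fun_upd:
  fixes F :: "('a \<Rightarrow> 'b) \<Rightarrow> 'c::comm_monoid_add"
  assumes "j \<in> S"
  shows "(\<Sum>b\<in>S \<rightarrow>\<^sub>E T. F b) = (\<Sum>b\<in>(S - {j}) \<rightarrow>\<^sub>E T. \<Sum>x\<in>T. F (b(j := x)))"
proof -
  have "(\<Sum>b\<in>S \<rightarrow>\<^sub>E T. F b) = (\<Sum>b\<in>insert j (S - {j}) \<rightarrow>\<^sub>E T. F b)"
    using assms by (simp add: insert_absorb)
  also have "\<dots> = (\<Sum>(x, b)\<in>T \<times> ((S - {j}) \<rightarrow>\<^sub>E T). F (b(j := x)))"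
    unfolding PiE_insert_eq
    by (subst sum.reindex[OF inj_combinator]) (auto simp: case_prod_unfold o_def)
  also have "\<dots> = (\<Sum>x\<in>T. \<Sum>b\<in>(S - {j}) \<rightarrow>\<^sub>E T. F (b(j := x)))"
    by (rule sum.cartesian_product[symmetric])
  also have "\<dots> = (\<Sum>b\<in>(S - {j}) \<rightarrow>\<^sub>E T. \<Sum>x\<in>T. F (b(j := x)))"
    by (rule sum.swap)
  finally show ?thesis .
qed

definition fourier :: "nat \<Rightarrow> nat \<Rightarrow> ((nat \<Rightarrow> nat) \<Rightarrow> complex) \<Rightarrow> (nat \<Rightarrow> nat) \<Rightarrow> complex" where
  "fourier n k \<phi> i = (\<Sum>b\<in>{1..k} \<rightarrow>\<^sub>E {1..n}. \<phi> b * (\<Prod>j\<in>{1..k}. root_unity n (i j) ^ b j))"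

text \<open>The sum over frequencies factors over positions, and orthogonality at any position where
  \<open>b\<close> and \<open>c\<close> differ makes the product 0.\<close>

lemma fourier_inversion:
  assumes n: "n > 0" and c: "c \<in> {1..k} \<rightarrow>\<^sub>E {1..n}"
  shows "(\<Sum>i\<in>{1..k} \<rightarrow>\<^sub>E {..<n}. fourier n k \<phi> i * (\<Prod>j\<in>{1..k}. inverse (root_unity n (i j)) ^ c j))
    = of_nat n ^ k * \<phi> c"
proof -
  let ?B = "{1..k} \<rightarrow>\<^sub>E {1..n}"
  have "(\<Sum>i\<in>{1..k} \<rightarrow>\<^sub>E {..<n}. fourier n k \<phi> i * (\<Prod>j\<in>{1..k}. inverse (root_unity n (i j)) ^ c j))
      = (\<Sum>b\<in>?B. \<phi> b * (\<Sum>i\<in>{1..k} \<rightarrow>\<^sub>E {..<n}.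
          \<Prod>j\<in>{1..k}. root_unity n (i j) ^ b j * inverse (root_unity n (i j)) ^ c j))"
    unfolding fourier_def sum_distrib_left sum_distrib_right
    by (subst sum.swap) (simp add: prod.distrib mult.assoc)
  also have "\<dots> = (\<Sum>b\<in>?B. if b = c then of_nat n ^ k * \<phi> c else 0)"
  proof (rule sum.cong[OF refl])
    fix b assume b: "b \<in> ?B"
    have "(\<Sum>i\<in>{1..k} \<rightarrow>\<^sub>E {..<n}.
          \<Prod>j\<in>{1..k}. root_unity n (i j) ^ b j * inverse (root_unity n (i j)) ^ c j) =
        (\<Prod>j\<in>{1..k}. \<Sum>i<n. root_unity n i ^ b j * inverse (root_unity n i) ^ c j)"
      by (rule prod_sum_PiE[symmetric]) auto
    also have "\<dots> = (\<Prod>j\<in>{1..k}. if b j = c j then of_nat n else 0)"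
    proof (rule prod.cong[OF refl])
      fix j assume j: "j \<in> {1..k}"
      \<comment> \<open>Frequency and entry enter symmetrically; exchanging them turns the summation
        index into the exponent, as in \<open>sum_root_unity\<close>.\<close>
      have "(\<Sum>i<n. root_unity n i ^ b j * inverse (root_unity n i) ^ c j) =
          (\<Sum>i<n. root_unity n (b j) ^ i * inverse (root_unity n (c j)) ^ i)"
        unfolding power_inverse by (simp add: root_unity_power_commute[of n _ "b j"] root_unity_power_commute[of n _ "c j"])
      then show "(\<Sum>i<n. root_unity n i ^ b j * inverse (root_unity n i) ^ c j) =
          (if b j = c j then of_nat n else 0)"
        unfolding sum_root_unity[OF n] root_unity_eq_iff'[OF PiE_mem[OF b j] PiE_mem[OF c j]] .
    qed
    also have "\<dots> = (if b = c then of_nat n ^ k else 0)"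
    proof (cases "b = c")
      case False
      then obtain j where "j \<in> {1..k}" "b j \<noteq> c j" using PiE_ext[OF b c] by blast
      then have "(\<Prod>j\<in>{1..k}. if b j = c j then of_nat n else 0) = (0::complex)"
        by (intro prod_zero) auto
      then show ?thesis using False by simp
    qed simp
    finally show "\<phi> b * (\<Sum>i\<in>{1..k} \<rightarrow>\<^sub>E {..<n}.
          \<Prod>j\<in>{1..k}. root_unity n (i j) ^ b j * inverse (root_unity n (i j)) ^ c j) =
        (if b = c then of_nat n ^ k * \<phi> c else 0)"
      by simp
  qed
  also have "\<dots> = of_nat n ^ k * \<phi> c"
    using c by (subst sum.delta) (auto intro!: finite_PiE)
  finally show ?thesis .
qed

text \<open>Swapping two positions of equal frequency keeps the character and negates
  \<open>\<phi>\<close>.\<close>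

lemma fourier_not_inj:
  assumes \<phi>: "alternating n k \<phi>" and i: "\<not> inj_on i {1..k}"
  shows "fourier n k \<phi> i = 0"
proof -
  obtain p q where pq: "p \<in> {1..k}" "q \<in> {1..k}" "p \<noteq> q" "i p = i q"
    using i by (auto simp: inj_on_def)
  let ?B = "{1..k} \<rightarrow>\<^sub>E {1..n}" and ?t = "transpose p q"
  have t: "?t permutes {1..k}" using pq by (intro permutes_swap_id)
  have it: "i (?t j) = i j" for j using pq by (auto simp: transpose_def)
  have tB: "b \<circ> ?t \<in> ?B" if "b \<in> ?B" for b
  proof (rule PiE_I)
    show "(b \<circ> ?t) j \<in> {1..n}" if "j \<in> {1..k}" for j
      using PiE_mem[OF \<open>b \<in> ?B\<close>, of "?t j"] permutes_in_image[OF t, of j] that by simp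
    show "(b \<circ> ?t) j = undefined" if "j \<notin> {1..k}" for j
      using PiE_arb[OF \<open>b \<in> ?B\<close>, of j] permutes_not_in[OF t that] that by simp
  qed
  have "fourier n k \<phi> i = (\<Sum>b\<in>?B. \<phi> (b \<circ> ?t) * (\<Prod>j\<in>{1..k}. root_unity n (i j) ^ (b \<circ> ?t) j))"
    unfolding fourier_def
    by (rule sum.reindex_bij_witness[where i = "\<lambda>b. b \<circ> ?t" and j = "\<lambda>b. b \<circ> ?t"])
      (use tB in \<open>auto simp: comp_assoc simp del: PiE_iff\<close>)
  also have "\<dots> = (\<Sum>b\<in>?B. - (\<phi> b * (\<Prod>j\<in>{1..k}. root_unity n (i j) ^ b j)))"
  proof (rule sum.cong[OF refl])
    fix b
    have "(\<Prod>j\<in>{1..k}. root_unity n (i j) ^ (b \<circ> ?t) j) = (\<Prod>j\<in>{1..k}. root_unity n (i j) ^ b j)"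
      by (subst (2) prod.permute[OF t]) (simp add: it o_def)
    moreover have "\<phi> (b \<circ> ?t) = - \<phi> b"
      using alternating_permute[OF \<phi> t] pq(3) by (simp add: sign_swap_id)
    ultimately show "\<phi> (b \<circ> ?t) * (\<Prod>j\<in>{1..k}. root_unity n (i j) ^ (b \<circ> ?t) j) =
        - (\<phi> b * (\<Prod>j\<in>{1..k}. root_unity n (i j) ^ b j))" by simp
  qed
  also have "\<dots> = - fourier n k \<phi> i" by (simp add: fourier_def sum_negf)
  finally show ?thesis by simp
qed

text \<open>With frequency 0 the character is constant in argument \<open>j\<close>, so the sum
  condition on \<open>\<phi>\<close> applies.\<close>

lemma fourier_0:
  assumes \<phi>: "alternating n k \<phi>" and j: "j \<in> {1..k}" "i j = 0"
  shows "fourier n k \<phi> i = 0"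
  unfolding fourier_def sum_PiE_fun_upd[OF j(1)]
proof (rule sum.neutral, rule ballI)
  fix b
  have "(\<Prod>l\<in>{1..k}. root_unity n (i l) ^ (b(j := x)) l) =
      (\<Prod>l\<in>{1..k} - {j}. root_unity n (i l) ^ b l)" for x
    using j by (subst prod.remove[of _ j]) (auto intro!: prod.cong)
  then show "(\<Sum>x\<in>{1..n}. \<phi> (b(j := x)) * (\<Prod>l\<in>{1..k}. root_unity n (i l) ^ (b(j := x)) l)) = 0"
    using alternating_sum_eq_0[OF \<phi> j(1), of b] by (simp add: sum_distrib_right[symmetric])
qed

text \<open>Substituting \<open>g \<circ> b\<close> for \<open>b\<close> keeps \<open>\<phi>\<close>
  and multiplies the character by the product of roots, so a nonzero coefficient forces this product
  to be 1. The hypothesis \<open>root\<close> expresses that \<open>g\<close> adds 1 modulo n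
  without a case for the wrap-around.\<close>

lemma fourier_shift:
  assumes \<phi>: "alternating n k \<phi>" and g: "g permutes {1..n}"
    and inv: "\<And>b. b ` {1..k} \<subseteq> {1..n} \<Longrightarrow> \<phi> (g \<circ> b) = \<phi> b"
    and root: "\<And>j x. x \<in> {1..n} \<Longrightarrow> root_unity n j ^ g x = root_unity n j * root_unity n j ^ x"
  shows "fourier n k \<phi> i = (\<Prod>j\<in>{1..k}. root_unity n (i j)) * fourier n k \<phi> i"
proof -
  let ?B = "{1..k} \<rightarrow>\<^sub>E {1..n}" and ?h = "Hilbert_Choice.inv g"
  \<comment> \<open>Composing with \<open>g\<close> may change the dummy value outside
    \<open>{1..k}\<close>, hence the restriction.\<close>
  let ?r = "\<lambda>g b. restrict (g \<circ> b) {1..k}"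
  have h: "?h permutes {1..n}" using g by (rule permutes_inv)
  have rB: "?r f b \<in> ?B" if "b \<in> ?B" "f permutes {1..n}" for f b
    using that(1) permutes_in_image[OF that(2)] by (auto simp: PiE_iff)
  have rr: "?r f (?r f' b) = b" if "b \<in> ?B" "\<And>x. f (f' x) = x" for f f' b
    using that by (intro ext) (auto simp: restrict_def PiE_iff extensional_def)
  have "fourier n k \<phi> i = (\<Sum>b\<in>?B. \<phi> (?r g b) * (\<Prod>j\<in>{1..k}. root_unity n (i j) ^ ?r g b j))"
    unfolding fourier_def
  proof (rule sum.reindex_bij_witness[where i = "?r g" and j = "?r ?h"])
    fix b assume b: "b \<in> ?B"
    show "?r g (?r ?h b) = b" "?r ?h (?r g b) = b" by (intro rr b permutes_inverses[OF g])+
    show "?r ?h b \<in> ?B" "?r g b \<in> ?B" using rB b g h by blast+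
    show "\<phi> (?r g (?r ?h b)) * (\<Prod>j\<in>{1..k}. root_unity n (i j) ^ ?r g (?r ?h b) j) =
        \<phi> b * (\<Prod>j\<in>{1..k}. root_unity n (i j) ^ b j)"
      unfolding \<open>?r g (?r ?h b) = b\<close> ..
  qed
  also have "\<dots> = (\<Sum>b\<in>?B. (\<Prod>j\<in>{1..k}. root_unity n (i j)) *
      (\<phi> b * (\<Prod>j\<in>{1..k}. root_unity n (i j) ^ b j)))"
  proof (rule sum.cong[OF refl])
    fix b assume b: "b \<in> ?B"
    have "\<phi> (?r g b) = \<phi> (g \<circ> b)" by (rule alternating_cong[OF \<phi>]) simp
    also have "\<dots> = \<phi> b" using b by (intro inv) blast
    finally have "\<phi> (?r g b) = \<phi> b" .
    moreover have "(\<Prod>j\<in>{1..k}. root_unity n (i j) ^ ?r g b j) =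
        (\<Prod>j\<in>{1..k}. root_unity n (i j) * root_unity n (i j) ^ b j)"
    proof (rule prod.cong[OF refl])
      fix j assume "j \<in> {1..k}"
      then show "root_unity n (i j) ^ ?r g b j = root_unity n (i j) * root_unity n (i j) ^ b j"
        using root[OF PiE_mem[OF b]] by simp
    qed
    ultimately show "\<phi> (?r g b) * (\<Prod>j\<in>{1..k}. root_unity n (i j) ^ ?r g b j) =
        (\<Prod>j\<in>{1..k}. root_unity n (i j)) * (\<phi> b * (\<Prod>j\<in>{1..k}. root_unity n (i j) ^ b j))"
      by (simp add: prod.distrib)
  qed
  also have "\<dots> = (\<Prod>j\<in>{1..k}. root_unity n (i j)) * fourier n k \<phi> i"
    by (simp only: fourier_def sum_distrib_left)
  finally show ?thesis .
qed

lemma exists_cycle: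
  assumes n: "n \<ge> 1"
  obtains g where "g permutes {1..n}"
    "\<And>j x. x \<in> {1..n} \<Longrightarrow> root_unity n j ^ g x = root_unity n j * root_unity n j ^ x"
proof -
  define g where "g x = (if x \<in> {1..<n} then x + 1 else if x = n then 1 else x)" for x
  have "g ` {1..n} \<subseteq> {1..n}" using n by (auto simp: g_def)
  moreover have "inj_on g {1..n}" by (auto simp: g_def inj_on_def)
  ultimately have "bij_betw g {1..n} {1..n}"
    unfolding bij_betw_def by (simp add: endo_inj_surj)
  then have "g permutes {1..n}" by (rule bij_imp_permutes) (use n in \<open>auto simp: g_def\<close>)
  moreover have "root_unity n j ^ g x = root_unity n j * root_unity n j ^ x" if "x \<in> {1..n}" for j x
  proof (cases "x = n")
    case True
    \<comment> \<open>At the wrap-around from n to 1 the law holds because the n-th power of the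
      root is 1.\<close>
    then show ?thesis using n root_unity_power[of n j] by (simp add: g_def)
  next
    case False
    then show ?thesis using that by (simp add: g_def power_add)
  qed
  ultimately show thesis by (rule that)
qed

text \<open>For the n-cycle every Fourier coefficient of an invariant function vanishes: by
  antisymmetry for repeated frequencies, by the sum condition for frequency 0, and by
  \<open>ne\<close> with \<open>fourier_shift\<close> otherwise.\<close>

lemma exists_no_invariant_alternating:
  assumes n: "n \<ge> 1"
    and ne: "\<And>i. inj_on i {1..k} \<Longrightarrow> i ` {1..k} \<subseteq> {1..<n} \<Longrightarrow> (\<Prod>j\<in>{1..k}. root_unity n (i j)) \<noteq> 1"
  obtains g where "g permutes {1..n}"
    "\<And>\<phi> b. alternating n k \<phi> \<Longrightarrow> (\<And>b. b ` {1..k} \<subseteq> {1..n} \<Longrightarrow> \<phi> (g \<circ> b) = \<phi> b) \<Longrightarrow>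
      b ` {1..k} \<subseteq> {1..n} \<Longrightarrow> \<phi> b = 0"
proof -
  obtain g where g: "g permutes {1..n}"
    "\<And>j x. x \<in> {1..n} \<Longrightarrow> root_unity n j ^ g x = root_unity n j * root_unity n j ^ x"
    using exists_cycle[OF n] by blast
  have "\<phi> b = 0" if \<phi>: "alternating n k \<phi>" and inv: "\<And>b. b ` {1..k} \<subseteq> {1..n} \<Longrightarrow> \<phi> (g \<circ> b) = \<phi> b"
    and b: "b ` {1..k} \<subseteq> {1..n}" for \<phi> b
  proof -
    let ?c = "restrict b {1..k}"
    have F0: "fourier n k \<phi> i = 0" if i: "i \<in> {1..k} \<rightarrow>\<^sub>E {..<n}" for i
    proof (cases "inj_on i {1..k} \<and> 0 \<notin> i ` {1..k}")
      case True
      have "i j \<in> {1..<n}" if "j \<in> {1..k}" for j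
      proof -
        have "i j \<noteq> 0" using True that by (metis image_eqI)
        then show ?thesis using PiE_mem[OF i that] by simp
      qed
      then have "(\<Prod>j\<in>{1..k}. root_unity n (i j)) \<noteq> 1" using True by (intro ne) auto
      then show ?thesis using fourier_shift[OF \<phi> g(1) inv g(2), of i] by auto
    next
      case False
      then show ?thesis using fourier_not_inj[OF \<phi>] fourier_0[OF \<phi>] by (metis imageE)
    qed
    have "?c \<in> {1..k} \<rightarrow>\<^sub>E {1..n}" using b by (auto simp: PiE_iff image_subset_iff)
    then have "of_nat n ^ k * \<phi> ?c = 0"
      using fourier_inversion[of n ?c k \<phi>] n F0 by simp
    moreover have "\<phi> ?c = \<phi> b" by (rule alternating_cong[OF \<phi>]) simp
    ultimately show ?thesis using n by simp
  qed
  with g(1) show thesis by (rule that)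
qed

text \<open>For n = 2m + 1 the exponents add up to n * m, a multiple of n.\<close>

lemma prod_root_unity_odd:
  assumes "odd n"
  shows "(\<Prod>j\<in>{1..<n}. root_unity n j) = 1"
proof -
  obtain m where m: "n = 2 * m + 1" using assms by (rule oddE)
  have "\<Sum>{1..<n} = \<Sum>{0..<n}"
    unfolding m by (rule sum.mono_neutral_left) (auto simp: Suc_le_eq One_nat_def)
  also have "\<dots> = n * m"
    unfolding m by (induction m) (simp_all add: One_nat_def algebra_simps)
  finally have "root_unity n (\<Sum>j\<in>{1..<n}. j) = 1"
    using root_unity_power[of n m] m by (simp add: root_unity_mult root_unity_power_commute)
  then show ?thesis by (simp add: root_unity_sum)
qed

text \<open>Exactly one nontrivial root is missing from a product that would be 1 when complete, so
  the value is the inverse of the missing root.\<close>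

lemma prod_root_unity_omit_one:
  assumes n: "odd n" "n \<ge> 2" and i: "inj_on i {1..n - 2}" "i ` {1..n - 2} \<subseteq> {1..<n}"
  shows "(\<Prod>j\<in>{1..n - 2}. root_unity n (i j)) \<noteq> 1"
proof -
  let ?K = "i ` {1..n - 2}"
  have "card ({1..<n} - ?K) = 1" using i n by (subst card_Diff_subset) (auto simp: card_image)
  then obtain q where q: "{1..<n} - ?K = {q}" by (rule card_1_singletonE)
  then have "{1..<n} = insert q ?K" "q \<notin> ?K" using i(2) by blast+
  then have "root_unity n q * (\<Prod>j\<in>?K. root_unity n j) = 1"
    using prod_root_unity_odd[OF n(1)] by simp
  moreover have "q \<in> {1..<n}" using q by blast
  then have "root_unity n q \<noteq> 1" by (intro root_unity_neq_1) auto
  moreover have "(\<Prod>j\<in>?K. root_unity n j) = (\<Prod>j\<in>{1..n - 2}. root_unity n (i j))"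
    by (simp add: prod.reindex[OF i(1)])
  ultimately show ?thesis by auto
qed

section \<open>The three statements on hooks\<close>

theorem theorem1p2:
  fixes n :: nat
  assumes "n \<ge> 5"
  shows "\<not> unisingular (sym_group n) fun_scale (specht [n - 1, 1]) perm_act \<and>
    (\<forall>k\<in>{2..n - 3}. unisingular (sym_group n) fun_scale (specht ((n - k) # replicate k 1)) perm_act) \<and>
    (unisingular (sym_group n) fun_scale (specht (2 # replicate (n - 2) 1)) perm_act \<longleftrightarrow> even n)"
proof -
  have pos: "unisingular (sym_group n) fun_scale (specht ((n - k) # replicate k 1)) perm_act"
    if k: "1 \<le> k" "even k \<and> k + 2 \<le> n \<or> odd k \<and> 3 \<le> k \<and> k + 3 \<le> n" for k
  proof -
    interpret H: hook n k "(n - k) # replicate k 1" by unfold_locales (use k in auto)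
    show ?thesis
      unfolding H.unisingular_hook_iff
    proof (intro allI impI)
      fix g assume g: "g permutes {1..n}"
      have n: "n \<ge> 1" using assms by simp
      show "\<exists>\<phi> b. alternating n k \<phi> \<and> b ` {1..k} \<subseteq> {1..n} \<and> \<phi> b \<noteq> 0 \<and>
          (\<forall>b. b ` {1..k} \<subseteq> {1..n} \<longrightarrow> \<phi> (g \<circ> b) = \<phi> b)"
        by (rule exists_invariant_alternating[OF g n k(2)]) blast
    qed
  qed
  have neg: "\<not> unisingular (sym_group n) fun_scale (specht ((n - k) # replicate k 1)) perm_act"
    if k: "1 \<le> k" "k < n"
      and ne: "\<And>i. inj_on i {1..k} \<Longrightarrow> i ` {1..k} \<subseteq> {1..<n} \<Longrightarrow> (\<Prod>j\<in>{1..k}. root_unity n (i j)) \<noteq> 1" for k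
  proof -
    interpret H: hook n k "(n - k) # replicate k 1" by unfold_locales (use k in auto)
    have n: "n \<ge> 1" using assms by simp
    show ?thesis
      unfolding H.unisingular_hook_iff by (rule exists_no_invariant_alternating[OF n ne]) blast+
  qed
  \<comment> \<open>For k = 1 the product is a single nontrivial root of unity.\<close>
  have "\<not> unisingular (sym_group n) fun_scale (specht ((n - 1) # replicate 1 1)) perm_act"
  proof (rule neg)
    fix i :: "nat \<Rightarrow> nat" assume "i ` {1..1} \<subseteq> {1..<n}"
    then have "i 1 \<in> {1..<n}" by simp
    then have "root_unity n (i 1) \<noteq> 1" by (intro root_unity_neq_1) auto
    then show "(\<Prod>j\<in>{1..1}. root_unity n (i j)) \<noteq> 1" by simp
  qed (use assms in auto)
  moreover have "unisingular (sym_group n) fun_scale (specht ((n - k) # replicate k 1)) perm_act"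
    if "k \<in> {2..n - 3}" for k
  proof (rule pos)
    have "2 \<le> k" "k + 3 \<le> n" using that assms by auto
    then show "1 \<le> k" "even k \<and> k + 2 \<le> n \<or> odd k \<and> 3 \<le> k \<and> k + 3 \<le> n" by presburger+
  qed
  moreover have "unisingular (sym_group n) fun_scale (specht ((n - (n - 2)) # replicate (n - 2) 1)) perm_act
      \<longleftrightarrow> even n"
  proof
    \<comment> \<open>Here k = n - 2 is even as well and attains the bound k + 2 \<le> n.\<close>
    assume "even n"
    then show "unisingular (sym_group n) fun_scale (specht ((n - (n - 2)) # replicate (n - 2) 1)) perm_act"
      using assms by (intro pos) auto
  next
    assume *: "unisingular (sym_group n) fun_scale (specht ((n - (n - 2)) # replicate (n - 2) 1)) perm_act"
    show "even n"
    proof (rule ccontr)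
      assume "odd n"
      then have "\<not> unisingular (sym_group n) fun_scale (specht ((n - (n - 2)) # replicate (n - 2) 1)) perm_act"
        using assms by (intro neg prod_root_unity_omit_one) auto
      with * show False by simp
    qed
  qed
  moreover have "n - (n - 2) = 2" using assms by simp
  ultimately show ?thesis by (simp add: One_nat_def)
qed

end
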